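(* (1) Let $H$ be a weak Hopf algebra and let $q\in H_t$ be an invertible element such that $S^2(q)=q$ and $S(1_{(1)})\,q\,1_{(2)}=1$. Then there is a weak Hopf algebra $H_q$ with the same underlying algebra as $H$ and with structure operations $$\Delta'(h)=\Delta(h)(1\otimes q),\qquad \epsilon'(h)=\epsilon(hq^{-1}),\qquad S'(h)=q^{-1}S(h)q,\qquad h\in H.$$ (2) Let $k$ be algebraically closed of characteristic $0$, and suppose the minimal weak Hopf subalgebra $H_{\min}=H_tH_s$ of $H$ is $H_{\min}(H_t,H_t\cap H_s,g)$, i.e. $g\in H_t$ is the invertible element determined by $\epsilon(b)=\mathrm{Tr}_{\mathrm{reg}}(g^{-1}b)$ for all $b\in H_t$, where $\mathrm{Tr}_{\mathrm{reg}}$ is the trace of the regular representation of $H_t$. Then $H_{g^{-1}}$ (the deformation in (1) with $q=g^{-1}$) is a weak Hopf algebra the square of whose antipode is the identity on its minimal weak Hopf subalgebra. In particular, every weak Hopf algebra is a deformation, of the form in (1), of a weak Hopf algebra with the property that the square of the antipode is the identity on the minimal weak Hopf subalgebra.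
   Context: A weak Hopf algebra over a field $k$ is a $k$-vector space $H$ with an associative unital algebra structure $(m,1)$, a coassociative counital coalgebra structure $(\Delta,\epsilon)$ (Sweedler notation $\Delta(h)=h_{(1)}\otimes h_{(2)}$) and a linear map $S:H\to H$ (antipode) such that for all $f,g,h\in H$: $\Delta(hg)=\Delta(h)\Delta(g)$; $(\Delta\otimes\mathrm{id})\Delta(1)=(\Delta(1)\otimes1)(1\otimes\Delta(1))=(1\otimes\Delta(1))(\Delta(1)\otimes1)$; $\epsilon(fgh)=\epsilon(fg_{(1)})\epsilon(g_{(2)}h)=\epsilon(fg_{(2)})\epsilon(g_{(1)}h)$; $m(\mathrm{id}\otimes S)\Delta(h)=(\epsilon\otimes\mathrm{id})(\Delta(1)(h\otimes1))$; $m(S\otimes\mathrm{id})\Delta(h)=(\mathrm{id}\otimes\epsilon)((1\otimes h)\Delta(1))$; $S(h)=S(h_{(1)})h_{(2)}S(h_{(3)})$. ($\Delta(1)=1_{(1)}\otimes 1_{(2)}\neq1\otimes1$ in general.) Counital maps: $\varepsilon_t(h)=\epsilon(1_{(1)}h)1_{(2)}$, $\varepsilon_s(h)=1_{(1)}\epsilon(h1_{(2)})$. Their images $H_t=\varepsilon_t(H)$, $H_s=\varepsilon_s(H)$ (the bases of $H$) are finite dimensional separable subalgebras of $H$ that commute with each other. $H_{\min}=H_tH_s$ is the minimal weak Hopf subalgebra of $H$ containing $1$. *)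

theory Defs
  imports "HOL-Library.Function_Algebras" "HOL-Computational_Algebra.Polynomial"
begin

section \<open>Tensor squares and cubes of a vector space\<close>

definition bilinear_map ::
  "('k::field \<Rightarrow> 'a::ab_group_add \<Rightarrow> 'a) \<Rightarrow> ('k \<Rightarrow> 'w::ab_group_add \<Rightarrow> 'w) \<Rightarrow> ('a \<Rightarrow> 'a \<Rightarrow> 'w) \<Rightarrow> bool"
  where "bilinear_map s sW f \<longleftrightarrow>
    (\<forall>a. Vector_Spaces.linear s sW (\<lambda>b. f a b)) \<and>
    (\<forall>b. Vector_Spaces.linear s sW (\<lambda>a. f a b))"

definition trilinear_map ::
  "('k::field \<Rightarrow> 'a::ab_group_add \<Rightarrow> 'a) \<Rightarrow> ('k \<Rightarrow> 'w::ab_group_add \<Rightarrow> 'w) \<Rightarrow> ('a \<Rightarrow> 'a \<Rightarrow> 'a \<Rightarrow> 'w) \<Rightarrow> bool"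
  where "trilinear_map s sW f \<longleftrightarrow>
    (\<forall>a b. Vector_Spaces.linear s sW (\<lambda>c. f a b c)) \<and>
    (\<forall>a c. Vector_Spaces.linear s sW (\<lambda>b. f a b c)) \<and>
    (\<forall>b c. Vector_Spaces.linear s sW (\<lambda>a. f a b c))"

text \<open>
  The tensor square of a vector space over a field is realised inside the space of functionals on
  bilinear forms: the pure tensor of \<open>a\<close> and \<open>b\<close> is evaluation at \<open>(a, b)\<close>, and the tensor square
  is the span of the pure tensors; likewise for the tensor cube and trilinear forms.  Evaluations
  are cut off to 0 on functions that are not multilinear.  That this is the tensor product, i.e.
  has the universal property, is proved in \<open>bilinear_tensor2\<close>, \<open>lift2\<close>, \<open>lift2_unique\<close> below (and
  in the analogous lemmas for the cube).
\<close>

definition fun_scale :: "'k::field \<Rightarrow> ('x \<Rightarrow> 'k) \<Rightarrow> ('x \<Rightarrow> 'k)"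
  where "fun_scale c t = (\<lambda>x. c * t x)"

type_synonym ('k, 'a) tensor2 = "('a \<Rightarrow> 'a \<Rightarrow> 'k) \<Rightarrow> 'k"
type_synonym ('k, 'a) tensor3 = "('a \<Rightarrow> 'a \<Rightarrow> 'a \<Rightarrow> 'k) \<Rightarrow> 'k"

definition tensor2 :: "('k::field \<Rightarrow> 'a::ab_group_add \<Rightarrow> 'a) \<Rightarrow> 'a \<Rightarrow> 'a \<Rightarrow> ('k, 'a) tensor2"
  where "tensor2 s a b = (\<lambda>\<beta>. if bilinear_map s (*) \<beta> then \<beta> a b else 0)"

definition tensor3 :: "('k::field \<Rightarrow> 'a::ab_group_add \<Rightarrow> 'a) \<Rightarrow> 'a \<Rightarrow> 'a \<Rightarrow> 'a \<Rightarrow> ('k, 'a) tensor3"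
  where "tensor3 s a b c = (\<lambda>\<tau>. if trilinear_map s (*) \<tau> then \<tau> a b c else 0)"

definition tensor2_space :: "('k::field \<Rightarrow> 'a::ab_group_add \<Rightarrow> 'a) \<Rightarrow> ('k, 'a) tensor2 set"
  where "tensor2_space s = module.span fun_scale {tensor2 s a b | a b. True}"

definition tensor3_space :: "('k::field \<Rightarrow> 'a::ab_group_add \<Rightarrow> 'a) \<Rightarrow> ('k, 'a) tensor3 set"
  where "tensor3_space s = module.span fun_scale {tensor3 s a b c | a b c. True}"

text \<open>
  \<open>lift2 s sW f\<close> is the linear map from the tensor square to \<open>W\<close> induced by a bilinear map \<open>f\<close>; it
  is determined on \<open>tensor2_space s\<close> only.  In Sweedler notation,
  \<open>lift2 s sW f (\<Delta> h)\<close> is the sum of the \<open>f h\<^sub>(\<^sub>1\<^sub>) h\<^sub>(\<^sub>2\<^sub>)\<close>.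
\<close>

definition lift2 ::
  "('k::field \<Rightarrow> 'a::ab_group_add \<Rightarrow> 'a) \<Rightarrow> ('k \<Rightarrow> 'w::ab_group_add \<Rightarrow> 'w) \<Rightarrow>
    ('a \<Rightarrow> 'a \<Rightarrow> 'w) \<Rightarrow> ('k, 'a) tensor2 \<Rightarrow> 'w"
  where "lift2 s sW f =
    (SOME F. Vector_Spaces.linear fun_scale sW F \<and> (\<forall>a b. F (tensor2 s a b) = f a b))"

definition lift3 ::
  "('k::field \<Rightarrow> 'a::ab_group_add \<Rightarrow> 'a) \<Rightarrow> ('k \<Rightarrow> 'w::ab_group_add \<Rightarrow> 'w) \<Rightarrow>
    ('a \<Rightarrow> 'a \<Rightarrow> 'a \<Rightarrow> 'w) \<Rightarrow> ('k, 'a) tensor3 \<Rightarrow> 'w"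
  where "lift3 s sW f =
    (SOME F. Vector_Spaces.linear fun_scale sW F \<and> (\<forall>a b c. F (tensor3 s a b c) = f a b c))"

lemma vector_space_fun_scale: "vector_space (fun_scale :: 'k::field \<Rightarrow> ('x \<Rightarrow> 'k) \<Rightarrow> ('x \<Rightarrow> 'k))"
  by unfold_locales (auto simp: fun_scale_def fun_eq_iff algebra_simps)

lemma vector_space_mult: "vector_space ((*) :: 'k::field \<Rightarrow> 'k \<Rightarrow> 'k)"
  by unfold_locales (auto simp: algebra_simps)

lemma linear_I:
  assumes "vector_space s" "vector_space sW"
    and "\<And>x y. F (x + y) = F x + F y" "\<And>c x. F (s c x) = sW c (F x)"
  shows "Vector_Spaces.linear s sW F"
  using assms
  by (simp add: linear_iff_module_hom module_hom_def module_hom_axioms_def module_iff_vector_space)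

lemma linear_eval: "Vector_Spaces.linear (fun_scale :: 'k::field \<Rightarrow> _) (*) (\<lambda>t. t x)"
  by (rule linear_I[OF vector_space_fun_scale vector_space_mult]) (simp_all add: fun_scale_def)

lemma linear_comp:
  assumes "Vector_Spaces.linear s1 s2 F" "Vector_Spaces.linear s2 s3 G"
  shows "Vector_Spaces.linear s1 s3 (\<lambda>x. G (F x))"
  using Vector_Spaces.linear_compose[OF assms] by (simp add: o_def)

lemma functionals_separate:
  assumes V: "vector_space (s :: 'k::field \<Rightarrow> 'w::ab_group_add \<Rightarrow> 'w)"
    and eq: "\<And>\<phi>. Vector_Spaces.linear s (*) \<phi> \<Longrightarrow> \<phi> v = \<phi> w"
  shows "v = w"
proof (rule ccontr)
  assume "v \<noteq> w"
  interpret vector_space s by (fact V)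
  define u where "u = v - w"
  have ind: "independent {u}" using \<open>v \<noteq> w\<close> by (simp add: u_def)
  define B where "B = extend_basis {u}"
  have B: "independent B" "span B = UNIV" "u \<in> B"
    using independent_extend_basis[OF ind] span_extend_basis[OF ind] extend_basis_superset[OF ind]
    by (auto simp: B_def)
  let ?\<phi> = "\<lambda>x. representation B x u"
  have lin: "Vector_Spaces.linear s (*) ?\<phi>" by (rule linear_representation[OF B(1,2)])
  then interpret \<phi>: Vector_Spaces.linear s "(*)" ?\<phi> .
  have "?\<phi> u = ?\<phi> v - ?\<phi> w" unfolding u_def[symmetric] using \<phi>.diff[of v w] by (simp add: u_def)
  with eq[OF lin] have "?\<phi> u = 0" by simp
  moreover have "?\<phi> u = 1" using representation_basis[OF B(1) B(3)] by simp
  ultimately show False by simp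
qed

lemma linear_extension_exists:
  fixes sT :: "'k::field \<Rightarrow> 't::ab_group_add \<Rightarrow> 't" and sW :: "'k \<Rightarrow> 'w::ab_group_add \<Rightarrow> 'w"
    and G :: "'x \<Rightarrow> 't"
  assumes T: "vector_space sT" and W: "vector_space sW"
    and ext: "\<And>\<phi>. Vector_Spaces.linear sW (*) \<phi> \<Longrightarrow>
      \<exists>\<Phi>. Vector_Spaces.linear sT (*) \<Phi> \<and> (\<forall>x. \<Phi> (G x) = \<phi> (f x))"
  shows "\<exists>F. Vector_Spaces.linear sT sW F \<and> (\<forall>x. F (G x) = f x)"
proof -
  interpret T: vector_space sT by (fact T)
  interpret TW: vector_space_pair sT sW using T W by (simp add: vector_space_pair_def)
  interpret TK: vector_space_pair sT "(*) :: 'k \<Rightarrow> 'k \<Rightarrow> 'k"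
    using T vector_space_mult by (simp add: vector_space_pair_def)
  obtain C where C: "C \<subseteq> range G" "T.independent C" "range G \<subseteq> T.span C"
    using T.maximal_independent_subset .
  define h where "h c = f (SOME x. G x = c)" for c
  define F where "F = TW.construct C h"
  have F: "Vector_Spaces.linear sT sW F" unfolding F_def by (rule TW.linear_construct[OF C(2)])
  have "F (G x) = f x" for x
  proof (rule functionals_separate[OF W])
    fix \<phi> assume \<phi>: "Vector_Spaces.linear sW ((*) :: 'k \<Rightarrow> 'k \<Rightarrow> 'k) \<phi>"
    then obtain \<Phi> where \<Phi>: "Vector_Spaces.linear sT (*) \<Phi>" "\<And>x. \<Phi> (G x) = \<phi> (f x)"
      using ext by blast
    have "\<phi> (F t) = \<Phi> t" if "t \<in> T.span C" for t
    proof (rule TK.linear_eq_on[OF _ _ that])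
      show "Vector_Spaces.linear sT (*) (\<lambda>t. \<phi> (F t))" by (rule linear_comp[OF F \<phi>])
      fix c assume c: "c \<in> C"
      then have "G (SOME x. G x = c) = c" using C(1) by (metis (mono_tags) imageE someI_ex subsetD)
      then show "\<phi> (F c) = \<Phi> c"
        using TW.construct_basis[OF C(2) c, of h] \<Phi>(2) by (metis F_def h_def)
    qed (rule \<Phi>(1))
    moreover have "G x \<in> T.span C" using C(3) by blast
    ultimately show "\<phi> (F (G x)) = \<phi> (f x)" using \<Phi>(2) by simp
  qed
  then show ?thesis using F by blast
qed

lemma bilinear_map_add_scale:
  assumes "bilinear_map s sW f"
  shows "f (a + a') b = f a b + f a' b" "f a (b + b') = f a b + f a b'"
    "f (s c a) b = sW c (f a b)" "f a (s c b) = sW c (f a b)"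
proof -
  interpret l: Vector_Spaces.linear s sW "\<lambda>a. f a b" using assms by (simp add: bilinear_map_def)
  interpret r: Vector_Spaces.linear s sW "\<lambda>b. f a b" using assms by (simp add: bilinear_map_def)
  show "f (a + a') b = f a b + f a' b" "f a (b + b') = f a b + f a b'"
    "f (s c a) b = sW c (f a b)" "f a (s c b) = sW c (f a b)"
    by (rule l.add r.add l.scale r.scale)+
qed

lemma trilinear_map_add_scale:
  assumes "trilinear_map s sW f"
  shows "f (x + x') b c = f x b c + f x' b c" "f a (x + x') c = f a x c + f a x' c"
    "f a b (x + x') = f a b x + f a b x'"
    "f (s r x) b c = sW r (f x b c)" "f a (s r x) c = sW r (f a x c)" "f a b (s r x) = sW r (f a b x)"
proof -
  interpret l: Vector_Spaces.linear s sW "\<lambda>a. f a b c" using assms by (simp add: trilinear_map_def)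
  interpret m: Vector_Spaces.linear s sW "\<lambda>b. f a b c" using assms by (simp add: trilinear_map_def)
  interpret r: Vector_Spaces.linear s sW "\<lambda>c. f a b c" using assms by (simp add: trilinear_map_def)
  show "f (x + x') b c = f x b c + f x' b c" "f a (x + x') c = f a x c + f a x' c"
    "f a b (x + x') = f a b x + f a b x'"
    "f (s r x) b c = sW r (f x b c)" "f a (s r x) c = sW r (f a x c)" "f a b (s r x) = sW r (f a b x)"
    by (rule l.add m.add r.add l.scale m.scale r.scale)+
qed

lemma bilinear_tensor2:
  assumes "vector_space s"
  shows "bilinear_map s fun_scale (tensor2 s)"
  unfolding bilinear_map_def
  by (auto intro!: linear_I[OF assms vector_space_fun_scale] ext
      simp: tensor2_def fun_scale_def bilinear_map_add_scale)

lemma trilinear_tensor3: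
  assumes "vector_space s"
  shows "trilinear_map s fun_scale (tensor3 s)"
  unfolding trilinear_map_def
  by (auto intro!: linear_I[OF assms vector_space_fun_scale] ext
      simp: tensor3_def fun_scale_def trilinear_map_add_scale)

lemma lift2:
  assumes f: "bilinear_map s sW f"
  shows "Vector_Spaces.linear fun_scale sW (lift2 s sW f)"
    and "lift2 s sW f (tensor2 s a b) = f a b"
proof -
  have W: "vector_space sW" using f by (auto simp: bilinear_map_def Vector_Spaces.linear_def)
  have "\<exists>F. Vector_Spaces.linear fun_scale sW F \<and>
      (\<forall>x. F (case x of (a, b) \<Rightarrow> tensor2 s a b) = (case x of (a, b) \<Rightarrow> f a b))"
  proof (rule linear_extension_exists[OF vector_space_fun_scale W])
    fix \<phi> assume \<phi>: "Vector_Spaces.linear sW (*) \<phi>"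
    have "bilinear_map s (*) (\<lambda>a b. \<phi> (f a b))"
      using f \<phi> by (auto simp: bilinear_map_def intro: linear_comp)
    then show "\<exists>\<Phi>. Vector_Spaces.linear fun_scale (*) \<Phi> \<and>
        (\<forall>x. \<Phi> (case x of (a, b) \<Rightarrow> tensor2 s a b) = \<phi> (case x of (a, b) \<Rightarrow> f a b))"
      by (intro exI[of _ "\<lambda>t. t (\<lambda>a b. \<phi> (f a b))"]) (auto simp: tensor2_def linear_eval)
  qed
  then have "\<exists>F. Vector_Spaces.linear fun_scale sW F \<and> (\<forall>a b. F (tensor2 s a b) = f a b)"
    by auto
  from someI_ex[OF this]
  show "Vector_Spaces.linear fun_scale sW (lift2 s sW f)" "lift2 s sW f (tensor2 s a b) = f a b"
    by (auto simp: lift2_def)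
qed

lemma lift3:
  assumes f: "trilinear_map s sW f"
  shows "Vector_Spaces.linear fun_scale sW (lift3 s sW f)"
    and "lift3 s sW f (tensor3 s a b c) = f a b c"
proof -
  have W: "vector_space sW" using f by (auto simp: trilinear_map_def Vector_Spaces.linear_def)
  have "\<exists>F. Vector_Spaces.linear fun_scale sW F \<and>
      (\<forall>x. F (case x of (a, b, c) \<Rightarrow> tensor3 s a b c) = (case x of (a, b, c) \<Rightarrow> f a b c))"
  proof (rule linear_extension_exists[OF vector_space_fun_scale W])
    fix \<phi> assume \<phi>: "Vector_Spaces.linear sW (*) \<phi>"
    have "trilinear_map s (*) (\<lambda>a b c. \<phi> (f a b c))"
      using f unfolding trilinear_map_def by (blast intro: linear_comp[OF _ \<phi>, of s "f a b" for a b]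
          linear_comp[OF _ \<phi>, of s "\<lambda>b. f a b c" for a c] linear_comp[OF _ \<phi>, of s "\<lambda>a. f a b c" for b c])
    then show "\<exists>\<Phi>. Vector_Spaces.linear fun_scale (*) \<Phi> \<and>
        (\<forall>x. \<Phi> (case x of (a, b, c) \<Rightarrow> tensor3 s a b c) = \<phi> (case x of (a, b, c) \<Rightarrow> f a b c))"
      by (intro exI[of _ "\<lambda>t. t (\<lambda>a b c. \<phi> (f a b c))"]) (auto simp: tensor3_def linear_eval)
  qed
  then have "\<exists>F. Vector_Spaces.linear fun_scale sW F \<and> (\<forall>a b c. F (tensor3 s a b c) = f a b c)"
    by auto
  from someI_ex[OF this]
  show "Vector_Spaces.linear fun_scale sW (lift3 s sW f)" "lift3 s sW f (tensor3 s a b c) = f a b c"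
    by (auto simp: lift3_def)
qed

lemma lift2_unique:
  fixes s :: "'k::field \<Rightarrow> 'a::ab_group_add \<Rightarrow> 'a" and sW :: "'k \<Rightarrow> 'w::ab_group_add \<Rightarrow> 'w"
  assumes f: "bilinear_map s sW f" and F: "Vector_Spaces.linear fun_scale sW F"
    and eq: "\<And>a b. F (tensor2 s a b) = f a b" and t: "t \<in> tensor2_space s"
  shows "F t = lift2 s sW f t"
proof -
  interpret vector_space_pair "fun_scale :: 'k \<Rightarrow> ('k, 'a) tensor2 \<Rightarrow> _" sW
    using F by (simp add: vector_space_pair_def Vector_Spaces.linear_def)
  show ?thesis
    by (rule linear_eq_on[OF F lift2(1)[OF f] t[unfolded tensor2_space_def]])
      (auto simp: eq lift2(2)[OF f])
qed

lemma lift3_unique: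
  fixes s :: "'k::field \<Rightarrow> 'a::ab_group_add \<Rightarrow> 'a" and sW :: "'k \<Rightarrow> 'w::ab_group_add \<Rightarrow> 'w"
  assumes f: "trilinear_map s sW f" and F: "Vector_Spaces.linear fun_scale sW F"
    and eq: "\<And>a b c. F (tensor3 s a b c) = f a b c" and t: "t \<in> tensor3_space s"
  shows "F t = lift3 s sW f t"
proof -
  interpret vector_space_pair "fun_scale :: 'k \<Rightarrow> ('k, 'a) tensor3 \<Rightarrow> _" sW
    using F by (simp add: vector_space_pair_def Vector_Spaces.linear_def)
  show ?thesis
    by (rule linear_eq_on[OF F lift3(1)[OF f] t[unfolded tensor3_space_def]])
      (auto simp: eq lift3(2)[OF f])
qed


section \<open>Weak Hopf algebras\<close>

text \<open>
  The sort \<open>{ring, monoid_mult}\<close> is that of associative unital rings; unlike \<open>ring_1\<close> it does not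
  exclude the zero ring.
\<close>

locale unital_algebra = vector_space scale
  for scale :: "'k::field \<Rightarrow> 'a::{ring, monoid_mult} \<Rightarrow> 'a" +
  assumes scale_mult_left: "scale c x * y = scale c (x * y)"
    and scale_mult_right: "x * scale c y = scale c (x * y)"

definition tensor2_mult ::
  "('k::field \<Rightarrow> 'a::{ring, monoid_mult} \<Rightarrow> 'a) \<Rightarrow> ('k, 'a) tensor2 \<Rightarrow> ('k, 'a) tensor2 \<Rightarrow> ('k, 'a) tensor2"
  where "tensor2_mult s t u =
    lift2 s fun_scale (\<lambda>a b. lift2 s fun_scale (\<lambda>c d. tensor2 s (a * c) (b * d)) u) t"

definition tensor3_mult ::
  "('k::field \<Rightarrow> 'a::{ring, monoid_mult} \<Rightarrow> 'a) \<Rightarrow> ('k, 'a) tensor3 \<Rightarrow> ('k, 'a) tensor3 \<Rightarrow> ('k, 'a) tensor3"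
  where "tensor3_mult s t u =
    lift3 s fun_scale (\<lambda>a b c. lift3 s fun_scale (\<lambda>x y z. tensor3 s (a * x) (b * y) (c * z)) u) t"

text \<open>\<open>\<Delta> \<otimes> id\<close> and \<open>id \<otimes> \<Delta>\<close>, both with values in the tensor cube\<close>

definition comult_id ::
  "('k::field \<Rightarrow> 'a::ab_group_add \<Rightarrow> 'a) \<Rightarrow> ('a \<Rightarrow> ('k, 'a) tensor2) \<Rightarrow> ('k, 'a) tensor2 \<Rightarrow> ('k, 'a) tensor3"
  where "comult_id s \<Delta> =
    lift2 s fun_scale (\<lambda>a b. lift2 s fun_scale (\<lambda>x y. tensor3 s x y b) (\<Delta> a))"

definition id_comult ::
  "('k::field \<Rightarrow> 'a::ab_group_add \<Rightarrow> 'a) \<Rightarrow> ('a \<Rightarrow> ('k, 'a) tensor2) \<Rightarrow> ('k, 'a) tensor2 \<Rightarrow> ('k, 'a) tensor3"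
  where "id_comult s \<Delta> =
    lift2 s fun_scale (\<lambda>a b. lift2 s fun_scale (\<lambda>x y. tensor3 s a x y) (\<Delta> b))"

text \<open>\<open>t \<mapsto> t \<otimes> 1\<close> and \<open>t \<mapsto> 1 \<otimes> t\<close>\<close>

definition tensor_one ::
  "('k::field \<Rightarrow> 'a::{ring, monoid_mult} \<Rightarrow> 'a) \<Rightarrow> ('k, 'a) tensor2 \<Rightarrow> ('k, 'a) tensor3"
  where "tensor_one s = lift2 s fun_scale (\<lambda>a b. tensor3 s a b 1)"

definition one_tensor ::
  "('k::field \<Rightarrow> 'a::{ring, monoid_mult} \<Rightarrow> 'a) \<Rightarrow> ('k, 'a) tensor2 \<Rightarrow> ('k, 'a) tensor3"
  where "one_tensor s = lift2 s fun_scale (\<lambda>a b. tensor3 s 1 a b)"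

locale weak_hopf_algebra = unital_algebra scale
  for scale :: "'k::field \<Rightarrow> 'a::{ring, monoid_mult} \<Rightarrow> 'a" +
  fixes \<Delta> :: "'a \<Rightarrow> ('k, 'a) tensor2" and \<epsilon> :: "'a \<Rightarrow> 'k" and S :: "'a \<Rightarrow> 'a"
  assumes comult_in: "\<Delta> h \<in> tensor2_space scale"
    and comult_linear: "Vector_Spaces.linear scale fun_scale \<Delta>"
    and counit_linear: "Vector_Spaces.linear scale (*) \<epsilon>"
    and antipode_linear: "Vector_Spaces.linear scale scale S"
    and coassociative: "comult_id scale \<Delta> (\<Delta> h) = id_comult scale \<Delta> (\<Delta> h)"
    and counit_left: "lift2 scale scale (\<lambda>a b. scale (\<epsilon> a) b) (\<Delta> h) = h"
    and counit_right: "lift2 scale scale (\<lambda>a b. scale (\<epsilon> b) a) (\<Delta> h) = h"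
    and comult_mult: "\<Delta> (h * g) = tensor2_mult scale (\<Delta> h) (\<Delta> g)"
    and comult_one_left: "comult_id scale \<Delta> (\<Delta> 1) =
          tensor3_mult scale (tensor_one scale (\<Delta> 1)) (one_tensor scale (\<Delta> 1))"
    and comult_one_right: "comult_id scale \<Delta> (\<Delta> 1) =
          tensor3_mult scale (one_tensor scale (\<Delta> 1)) (tensor_one scale (\<Delta> 1))"
    and counit_mult_12: "\<epsilon> (f * g * h) = lift2 scale (*) (\<lambda>a b. \<epsilon> (f * a) * \<epsilon> (b * h)) (\<Delta> g)"
    and counit_mult_21: "\<epsilon> (f * g * h) = lift2 scale (*) (\<lambda>a b. \<epsilon> (f * b) * \<epsilon> (a * h)) (\<Delta> g)"
    and antipode_right: "lift2 scale scale (\<lambda>a b. a * S b) (\<Delta> h) =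
          lift2 scale scale (\<lambda>a b. scale (\<epsilon> a) b) (tensor2_mult scale (\<Delta> 1) (tensor2 scale h 1))"
    and antipode_left: "lift2 scale scale (\<lambda>a b. S a * b) (\<Delta> h) =
          lift2 scale scale (\<lambda>a b. scale (\<epsilon> b) a) (tensor2_mult scale (tensor2 scale 1 h) (\<Delta> 1))"
    and antipode_eq: "S h =
          lift3 scale scale (\<lambda>a b c. S a * b * S c) (comult_id scale \<Delta> (\<Delta> h))"

definition counital_t ::
  "('k::field \<Rightarrow> 'a::{ring, monoid_mult} \<Rightarrow> 'a) \<Rightarrow> ('a \<Rightarrow> ('k, 'a) tensor2) \<Rightarrow> ('a \<Rightarrow> 'k) \<Rightarrow> 'a \<Rightarrow> 'a"
  where "counital_t s \<Delta> \<epsilon> h = lift2 s s (\<lambda>a b. s (\<epsilon> (a * h)) b) (\<Delta> 1)"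

definition counital_s ::
  "('k::field \<Rightarrow> 'a::{ring, monoid_mult} \<Rightarrow> 'a) \<Rightarrow> ('a \<Rightarrow> ('k, 'a) tensor2) \<Rightarrow> ('a \<Rightarrow> 'k) \<Rightarrow> 'a \<Rightarrow> 'a"
  where "counital_s s \<Delta> \<epsilon> h = lift2 s s (\<lambda>a b. s (\<epsilon> (h * b)) a) (\<Delta> 1)"

definition target_base ::
  "('k::field \<Rightarrow> 'a::{ring, monoid_mult} \<Rightarrow> 'a) \<Rightarrow> ('a \<Rightarrow> ('k, 'a) tensor2) \<Rightarrow> ('a \<Rightarrow> 'k) \<Rightarrow> 'a set"
  where "target_base s \<Delta> \<epsilon> = range (counital_t s \<Delta> \<epsilon>)"

definition source_base ::
  "('k::field \<Rightarrow> 'a::{ring, monoid_mult} \<Rightarrow> 'a) \<Rightarrow> ('a \<Rightarrow> ('k, 'a) tensor2) \<Rightarrow> ('a \<Rightarrow> 'k) \<Rightarrow> 'a set"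
  where "source_base s \<Delta> \<epsilon> = range (counital_s s \<Delta> \<epsilon>)"

definition min_subalgebra ::
  "('k::field \<Rightarrow> 'a::{ring, monoid_mult} \<Rightarrow> 'a) \<Rightarrow> ('a \<Rightarrow> ('k, 'a) tensor2) \<Rightarrow> ('a \<Rightarrow> 'k) \<Rightarrow> 'a set"
  where "min_subalgebra s \<Delta> \<epsilon> =
    module.span s {x * y | x y. x \<in> target_base s \<Delta> \<epsilon> \<and> y \<in> source_base s \<Delta> \<epsilon>}"


section \<open>Deformation\<close>

definition invertible_elem :: "'a::monoid_mult \<Rightarrow> bool"
  where "invertible_elem x \<longleftrightarrow> (\<exists>y. x * y = 1 \<and> y * x = 1)"

definition inverse_elem :: "'a::monoid_mult \<Rightarrow> 'a"
  where "inverse_elem x = (THE y. x * y = 1 \<and> y * x = 1)"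

definition deformation_elem ::
  "('k::field \<Rightarrow> 'a::{ring, monoid_mult} \<Rightarrow> 'a) \<Rightarrow> ('a \<Rightarrow> ('k, 'a) tensor2) \<Rightarrow> ('a \<Rightarrow> 'k) \<Rightarrow> ('a \<Rightarrow> 'a) \<Rightarrow> 'a \<Rightarrow> bool"
  where "deformation_elem s \<Delta> \<epsilon> S q \<longleftrightarrow>
    q \<in> target_base s \<Delta> \<epsilon> \<and> invertible_elem q \<and> S (S q) = q \<and>
    lift2 s s (\<lambda>a b. S a * q * b) (\<Delta> 1) = 1"

definition deform_comult ::
  "('k::field \<Rightarrow> 'a::{ring, monoid_mult} \<Rightarrow> 'a) \<Rightarrow> 'a \<Rightarrow> ('a \<Rightarrow> ('k, 'a) tensor2) \<Rightarrow> 'a \<Rightarrow> ('k, 'a) tensor2"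
  where "deform_comult s q \<Delta> h = tensor2_mult s (\<Delta> h) (tensor2 s 1 q)"

definition deform_counit :: "'a::{ring, monoid_mult} \<Rightarrow> ('a \<Rightarrow> 'k) \<Rightarrow> 'a \<Rightarrow> 'k"
  where "deform_counit q \<epsilon> h = \<epsilon> (h * inverse_elem q)"

definition deform_antipode :: "'a::{ring, monoid_mult} \<Rightarrow> ('a \<Rightarrow> 'a) \<Rightarrow> 'a \<Rightarrow> 'a"
  where "deform_antipode q S h = inverse_elem q * S h * q"


section \<open>The trace of the regular representation\<close>

text \<open>
  Trace of a linear endomorphism \<open>f\<close> of a finite-dimensional subspace \<open>V\<close>: the sum of the diagonal
  coefficients of \<open>f\<close> in some basis of \<open>V\<close>.
\<close>

definition trace_on ::
  "('k::field \<Rightarrow> 'a::ab_group_add \<Rightarrow> 'a) \<Rightarrow> 'a set \<Rightarrow> ('a \<Rightarrow> 'a) \<Rightarrow> 'k"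
  where "trace_on s V f =
    (let B = (SOME B. \<not> module.dependent s B \<and> module.span s B = V)
     in \<Sum>b\<in>B. module.representation s B (f b) b)"

definition regular_trace ::
  "('k::field \<Rightarrow> 'a::{ring, monoid_mult} \<Rightarrow> 'a) \<Rightarrow> 'a set \<Rightarrow> 'a \<Rightarrow> 'k"
  where "regular_trace s A x = trace_on s A (\<lambda>y. x * y)"

text \<open>\<open>g\<close> is the element for which the minimal weak Hopf subalgebra is \<open>H_min(H_t, H_t \<inter> H_s, g)\<close>.\<close>

definition min_datum ::
  "('k::field \<Rightarrow> 'a::{ring, monoid_mult} \<Rightarrow> 'a) \<Rightarrow> ('a \<Rightarrow> ('k, 'a) tensor2) \<Rightarrow> ('a \<Rightarrow> 'k) \<Rightarrow> 'a \<Rightarrow> bool"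
  where "min_datum s \<Delta> \<epsilon> g \<longleftrightarrow>
    g \<in> target_base s \<Delta> \<epsilon> \<and> invertible_elem g \<and>
    (\<forall>b\<in>target_base s \<Delta> \<epsilon>. \<epsilon> b = regular_trace s (target_base s \<Delta> \<epsilon>) (inverse_elem g * b))"

end

theory Submission
  imports Defs
begin

text \<open>
  Write \<open>\<Delta>(h) = h\<^sub>1 \<otimes> h\<^sub>2\<close> and \<open>\<Delta>(1) = 1\<^sub>1 \<otimes> 1\<^sub>2\<close>, and let \<open>H\<^sub>t\<close>, \<open>H\<^sub>s\<close> be the two bases.  All computations are Sweedler
  calculus: a representative of each \<open>\<Delta>(h)\<close> as a list of pairs is fixed once and for all, and \<open>sw f h\<close> is the sum of
  \<open>f h\<^sub>1 h\<^sub>2\<close>.  The axioms become rewrite rules for \<open>sw\<close> applied to multilinear maps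
  (\<open>weak_hopf_algebra_iff\<close>).
  
  Deformation.  For \<open>z\<close> in \<open>H\<^sub>t\<close> one has \<open>\<Delta>(h z) = h\<^sub>1 z \<otimes> h\<^sub>2\<close>, so \<open>\<Delta>'(h) = h\<^sub>1 \<otimes> h\<^sub>2 q\<close> is coassociative and
  \<open>\<epsilon>'(h) = \<epsilon>(h q\<^sup>-\<^sup>1)\<close> is its counit.  It is multiplicative because \<open>\<Delta>(1)(1 \<otimes> q)\<Delta>(1) = \<Delta>(1)\<close> (\<open>sw_q_one\<close>): elements \<open>y\<close> of
  \<open>H\<^sub>s\<close> can be moved across \<open>\<Delta>(1)\<close> by \<open>1\<^sub>1 y \<otimes> 1\<^sub>2 = 1\<^sub>1 \<otimes> 1\<^sub>2 S(y)\<close> (\<open>sw_one_Hs\<close>), which produces the factor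
  \<open>S(1\<^sub>1) q 1\<^sub>2 = 1\<close>.  The antipode axioms reduce to \<open>S(h\<^sub>1) q h\<^sub>2 = \<epsilon>\<^sub>s(h)\<close> and \<open>h\<^sub>1 S(q) S(h\<^sub>2) = \<epsilon>\<^sub>t(h)\<close>; the second rests
  on the image of \<open>S(1\<^sub>1) q 1\<^sub>2 = 1\<close> under \<open>S\<close>, since \<open>S\<close> is antimultiplicative (\<open>S_mult\<close>) and \<open>S(1\<^sub>2) \<otimes> S(1\<^sub>1) = \<Delta>(1)\<close> (\<open>sw_flip\<close>).
  
  Trace.  Each \<open>t\<close> in \<open>H\<^sub>t\<close> equals \<open>\<epsilon>(1\<^sub>1 t) 1\<^sub>2 = \<epsilon>(t S(1\<^sub>1)) 1\<^sub>2\<close>, so \<open>S(1\<^sub>1)\<close> and \<open>1\<^sub>2\<close> are dual bases for the form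
  \<open>\<epsilon>(a b)\<close> on \<open>H\<^sub>t\<close>, and the trace of the regular representation is \<open>b \<mapsto> \<epsilon>(b c)\<close> with \<open>c = 1\<^sub>2 S(1\<^sub>1)\<close> (\<open>casimir\<close>, \<open>Tr_eq\<close>).  As the trace is
  symmetric and \<open>S\<^sup>2\<close> is the Nakayama automorphism of \<open>\<epsilon>\<close> on \<open>H\<^sub>t\<close> (\<open>counit_S_S\<close>), one gets \<open>b c = c S\<^sup>2(b)\<close>.
  Averaging a linear projection with the separability idempotent \<open>S(1\<^sub>1) \<otimes> 1\<^sub>2\<close> shows that every left ideal of \<open>H\<^sub>t\<close> is generated
  by an idempotent (\<open>left_ideal_idempotent\<close>).  In characteristic 0 an idempotent of trace 0 vanishes, so
  the radical of the trace form is zero, and hence \<open>c\<close> is invertible.  Consequently \<open>g = c\<close> is the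
  unique element with \<open>\<epsilon>(b) = Tr(g\<^sup>-\<^sup>1 b)\<close>, and for \<open>q = c\<^sup>-\<^sup>1\<close>,
  \<open>S(1\<^sub>1) q 1\<^sub>2 = S(1\<^sub>1) S\<^sup>2(1\<^sub>2) q = 1\<^sub>2 S(1\<^sub>1) q = 1\<close>.  The square of the deformed antipode is conjugation by \<open>c\<close> after \<open>S\<^sup>2\<close> on
  \<open>H\<^sub>t\<close>, i.e. the identity, and it is the identity on \<open>H\<^sub>s = S(H\<^sub>t)\<close> too.  Deforming back by \<open>c\<close> recovers \<open>H\<close>.
\<close>

section \<open>Sums over representatives of tensors\<close>

definition sum_pairs :: "('a \<Rightarrow> 'a \<Rightarrow> 'w::ab_group_add) \<Rightarrow> ('a \<times> 'a) list \<Rightarrow> 'w"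
  where "sum_pairs f xs = sum_list (map (\<lambda>p. f (fst p) (snd p)) xs)"

lemma sum_pairs_simps [simp]:
  "sum_pairs f [] = 0" "sum_pairs f (p # xs) = f (fst p) (snd p) + sum_pairs f xs"
  by (simp_all add: sum_pairs_def)

lemma sum_pairs_zero: "sum_pairs (\<lambda>a b. 0) xs = 0"
  by (induction xs) auto

lemma sum_pairs_add: "sum_pairs (\<lambda>a b. f a b + g a b) xs = sum_pairs f xs + sum_pairs g xs"
  by (induction xs) (auto simp: algebra_simps)

lemma sum_pairs_swap:
  "sum_pairs (\<lambda>a b. sum_pairs (\<lambda>c d. f a b c d) ys) xs
    = sum_pairs (\<lambda>c d. sum_pairs (\<lambda>a b. f a b c d) xs) ys"
  by (induction xs) (auto simp: sum_pairs_add sum_pairs_zero)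

lemma linear_sum_pairs:
  assumes "Vector_Spaces.linear s sW F"
  shows "F (sum_pairs f xs) = sum_pairs (\<lambda>a b. F (f a b)) xs"
proof -
  interpret F: Vector_Spaces.linear s sW F by (fact assms)
  show ?thesis by (induction xs) (auto simp: F.add F.zero)
qed

lemma lift2_sum_pairs:
  assumes "bilinear_map s sW f"
  shows "lift2 s sW f (sum_pairs (\<lambda>a b. tensor2 s (g a b) (h a b)) xs)
    = sum_pairs (\<lambda>a b. f (g a b) (h a b)) xs"
  by (simp add: linear_sum_pairs[OF lift2(1)[OF assms]] lift2(2)[OF assms])

lemma lift3_sum_pairs:
  assumes "trilinear_map s sW f"
  shows "lift3 s sW f (sum_pairs (\<lambda>a b. tensor3 s (g a b) (h a b) (k a b)) xs)
    = sum_pairs (\<lambda>a b. f (g a b) (h a b) (k a b)) xs"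
  by (simp add: linear_sum_pairs[OF lift3(1)[OF assms]] lift3(2)[OF assms])

lemma tensor2_space_sum_pairs:
  assumes s: "vector_space s" and t: "t \<in> tensor2_space s"
  shows "\<exists>xs. t = sum_pairs (tensor2 s) xs"
proof -
  interpret T: vector_space fun_scale by (rule vector_space_fun_scale)
  note b = bilinear_map_add_scale[OF bilinear_tensor2[OF s]]
  show ?thesis
    using t unfolding tensor2_space_def
  proof (induction rule: T.span_induct_alt)
    case base
    have "0 = sum_pairs (tensor2 s) []" by simp
    then show ?case by blast
  next
    case (step c x y)
    then obtain a b xs where "x = tensor2 s a b" "y = sum_pairs (tensor2 s) xs" by auto
    then have "fun_scale c x + y = sum_pairs (tensor2 s) ((s c a, b) # xs)" by (simp add: b)
    then show ?case by blast
  qed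
qed

lemma sum_pairs_in_tensor2_space: "sum_pairs (tensor2 s) xs \<in> tensor2_space s"
proof -
  interpret T: vector_space fun_scale by (rule vector_space_fun_scale)
  show ?thesis unfolding tensor2_space_def
  proof (induction xs)
    case Nil
    show ?case unfolding sum_pairs_simps by (rule T.span_zero)
  next
    case (Cons p xs)
    show ?case unfolding sum_pairs_simps by (intro T.span_add T.span_base Cons.IH) blast
  qed
qed

lemma bilinearI:
  assumes "\<And>a. Vector_Spaces.linear s sW (\<lambda>b. f a b)" "\<And>b. Vector_Spaces.linear s sW (\<lambda>a. f a b)"
  shows "bilinear_map s sW f"
  using assms by (auto simp: bilinear_map_def)

lemma trilinearI:
  assumes "\<And>a b. Vector_Spaces.linear s sW (\<lambda>c. f a b c)"
    "\<And>a c. Vector_Spaces.linear s sW (\<lambda>b. f a b c)"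
    "\<And>b c. Vector_Spaces.linear s sW (\<lambda>a. f a b c)"
  shows "trilinear_map s sW f"
  using assms by (auto simp: trilinear_map_def)

lemma bilinear_linear:
  assumes "bilinear_map s sW f" and "Vector_Spaces.linear s' s F"
  shows "Vector_Spaces.linear s' sW (\<lambda>x. f (F x) b)" "Vector_Spaces.linear s' sW (\<lambda>x. f a (F x))"
  using assms linear_comp[of s' s F sW "\<lambda>a. f a b"] linear_comp[of s' s F sW "\<lambda>b. f a b"]
  by (auto simp: bilinear_map_def)

lemma trilinear_linear:
  assumes "trilinear_map s sW f" and "Vector_Spaces.linear s' s F"
  shows "Vector_Spaces.linear s' sW (\<lambda>x. f (F x) b c)" "Vector_Spaces.linear s' sW (\<lambda>x. f a (F x) c)"
    "Vector_Spaces.linear s' sW (\<lambda>x. f a b (F x))"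
  using assms linear_comp[of s' s F sW "\<lambda>a. f a b c"] linear_comp[of s' s F sW "\<lambda>b. f a b c"]
    linear_comp[of s' s F sW "\<lambda>c. f a b c"]
  by (auto simp: trilinear_map_def)

lemma linear_cod: "Vector_Spaces.linear s sW F \<Longrightarrow> vector_space sW"
  by (simp add: Vector_Spaces.linear_def)

lemma bilinear_cod: "bilinear_map s sW f \<Longrightarrow> vector_space sW"
  by (auto simp: bilinear_map_def Vector_Spaces.linear_def)

lemma linear_sum_pairs_intro:
  assumes "vector_space s" "vector_space sW" "\<And>a b. Vector_Spaces.linear s sW (\<lambda>x. G x a b)"
  shows "Vector_Spaces.linear s sW (\<lambda>x. sum_pairs (G x) xs)"
proof (rule linear_I[OF assms(1,2)])
  interpret W: vector_space sW by (fact assms(2))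
  have a: "G (x + y) a b = G x a b + G y a b" and c: "G (s c x) a b = sW c (G x a b)" for x y c a b
  proof -
    interpret G: Vector_Spaces.linear s sW "\<lambda>x. G x a b" by (rule assms(3))
    show "G (x + y) a b = G x a b + G y a b" "G (s c x) a b = sW c (G x a b)" by (rule G.add G.scale)+
  qed
  have a': "G (x + y) = (\<lambda>a b. G x a b + G y a b)" for x y by (intro ext) (rule a)
  show "sum_pairs (G (x + y)) xs = sum_pairs (G x) xs + sum_pairs (G y) xs" for x y
    by (simp add: a' sum_pairs_add)
  show "sum_pairs (G (s c x)) xs = sW c (sum_pairs (G x) xs)" for c x
    by (induction xs) (auto simp: c W.scale_right_distrib)
qed

lemma linear_scalar_intro:
  assumes "vector_space sW" "Vector_Spaces.linear s (*) F"
  shows "Vector_Spaces.linear s sW (\<lambda>x. sW (F x) v)"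
proof -
  interpret W: vector_space sW by fact
  interpret F: Vector_Spaces.linear s "(*)" F by fact
  show ?thesis
    by (rule linear_I) (use assms in \<open>auto simp: Vector_Spaces.linear_def F.add F.scale W.scale_left_distrib\<close>)
qed

lemma linear_const_scale_intro:
  assumes "Vector_Spaces.linear s sW F"
  shows "Vector_Spaces.linear s sW (\<lambda>x. sW c (F x))"
proof -
  interpret F: Vector_Spaces.linear s sW F by fact
  show ?thesis
    by (rule linear_I) (use assms in \<open>auto simp: Vector_Spaces.linear_def F.add F.scale
      F.vs2.scale_right_distrib F.vs2.scale_left_commute\<close>)
qed

context unital_algebra
begin

lemma linear_id': "Vector_Spaces.linear scale scale (\<lambda>x. x)"
  by (rule linear_I) (auto intro: vector_space_axioms)

lemma linear_mult_intro:
  assumes F: "Vector_Spaces.linear s scale F"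
  shows "Vector_Spaces.linear s scale (\<lambda>x. F x * c)" "Vector_Spaces.linear s scale (\<lambda>x. c * F x)"
proof -
  have "Vector_Spaces.linear scale scale (\<lambda>x. x * c)" "Vector_Spaces.linear scale scale (\<lambda>x. c * x)"
    by (rule linear_I[OF vector_space_axioms vector_space_axioms],
        simp_all only: distrib_left distrib_right scale_mult_left scale_mult_right)+
  from this[THEN linear_comp[OF F]]
  show "Vector_Spaces.linear s scale (\<lambda>x. F x * c)" "Vector_Spaces.linear s scale (\<lambda>x. c * F x)" .
qed

lemma linear_times_intro:
  assumes F: "Vector_Spaces.linear s ((*) :: 'b \<Rightarrow> 'b::field \<Rightarrow> 'b) F"
  shows "Vector_Spaces.linear s (*) (\<lambda>x. F x * c)" "Vector_Spaces.linear s (*) (\<lambda>x. c * F x)"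
proof -
  have "Vector_Spaces.linear (*) (*) (\<lambda>x. x * c)" "Vector_Spaces.linear (*) (*) (\<lambda>x. c * x)"
    by (rule linear_I[OF vector_space_mult vector_space_mult],
        simp_all only: distrib_left distrib_right mult.assoc mult.left_commute)+
  from this[THEN linear_comp[OF F]]
  show "Vector_Spaces.linear s (*) (\<lambda>x. F x * c)" "Vector_Spaces.linear s (*) (\<lambda>x. c * F x)" .
qed

text \<open>
  Multilinearity of a concrete expression is proved by \<open>intro\<close> with this collection: each rule peels off one operation around the
  bound variable.
\<close>

lemmas lin_basic =
  bilinearI trilinearI linear_id' linear_mult_intro linear_times_intro
  linear_scalar_intro[OF vector_space_axioms] linear_const_scale_intro[of _ scale]
  bilinear_linear[OF bilinear_tensor2[OF vector_space_axioms]]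
  trilinear_linear[OF trilinear_tensor3[OF vector_space_axioms]]

end

section \<open>Sweedler calculus\<close>

text \<open>
  The function \<open>D\<close> chooses a representative of each \<open>\<Delta> h\<close>, so that Sweedler sums are ordinary list sums which can be
  interchanged freely.  The weak Hopf algebra axioms are kept out of this locale: it is also used for
  the deformed operations, before they are known to satisfy them.
\<close>

locale sweedler = unital_algebra scale
  for scale :: "'k::field \<Rightarrow> 'a::{ring, monoid_mult} \<Rightarrow> 'a" +
  fixes \<Delta> :: "'a \<Rightarrow> ('k, 'a) tensor2" and D :: "'a \<Rightarrow> ('a \<times> 'a) list"
    and \<epsilon> :: "'a \<Rightarrow> 'k" and S :: "'a \<Rightarrow> 'a"
  assumes comult_eq: "\<Delta> h = sum_pairs (tensor2 scale) (D h)"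
    and comult_lin: "Vector_Spaces.linear scale fun_scale \<Delta>"
    and counit_lin: "Vector_Spaces.linear scale (*) \<epsilon>"
    and antipode_lin: "Vector_Spaces.linear scale scale S"
begin

definition sw :: "('a \<Rightarrow> 'a \<Rightarrow> 'w::ab_group_add) \<Rightarrow> 'a \<Rightarrow> 'w"
  where "sw f h = sum_pairs f (D h)"

lemma lift2_comult: "bilinear_map scale sW f \<Longrightarrow> lift2 scale sW f (\<Delta> h) = sw f h"
  unfolding comult_eq sw_def by (rule lift2_sum_pairs)

text \<open>
  Although the choice \<open>D\<close> is not linear, \<open>sw f\<close> is linear for bilinear \<open>f\<close>, being a function of the tensor \<open>\<Delta> h\<close> only.
\<close>

lemma sw_lin:
  assumes "bilinear_map scale sW f" "Vector_Spaces.linear s scale F"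
  shows "Vector_Spaces.linear s sW (\<lambda>x. sw f (F x))"
  unfolding lift2_comult[OF assms(1), symmetric]
  by (rule linear_comp[OF linear_comp[OF assms(2) comult_lin] lift2(1)[OF assms(1)]])

lemma sw_lin':
  assumes "\<And>a b. Vector_Spaces.linear scale sW (\<lambda>x. G x a b)"
  shows "Vector_Spaces.linear scale sW (\<lambda>x. sw (G x) h)"
  unfolding sw_def
  by (rule linear_sum_pairs_intro[OF vector_space_axioms linear_cod[OF assms[of 0 0]] assms])

lemmas lin = lin_basic sw_lin sw_lin' linear_comp[OF _ counit_lin] linear_comp[OF _ antipode_lin]

lemma sw_swap: "sw (\<lambda>a b. sw (\<lambda>c d. f a b c d) g) h = sw (\<lambda>c d. sw (\<lambda>a b. f a b c d) h) g"
  unfolding sw_def by (rule sum_pairs_swap)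

lemma linear_sw: "Vector_Spaces.linear s sW F \<Longrightarrow> F (sw f h) = sw (\<lambda>a b. F (f a b)) h"
  unfolding sw_def by (rule linear_sum_pairs)

lemma mult_sw:
  fixes f :: "'a \<Rightarrow> 'a \<Rightarrow> 'a"
  shows "c * sw f h = sw (\<lambda>a b. c * f a b) h" "sw f h * c = sw (\<lambda>a b. f a b * c) h"
proof -
  have l: "Vector_Spaces.linear scale scale (\<lambda>x. c * x)" and r: "Vector_Spaces.linear scale scale (\<lambda>x. x * c)"
    by (intro lin)+
  show "c * sw f h = sw (\<lambda>a b. c * f a b) h" by (rule linear_sw[OF l])
  show "sw f h * c = sw (\<lambda>a b. f a b * c) h" by (rule linear_sw[OF r])
qed

lemma comult_id_sw:
  "comult_id scale \<Delta> (\<Delta> h) = sw (\<lambda>a b. sw (\<lambda>x y. tensor3 scale x y b) a) h"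
proof -
  have "lift2 scale fun_scale (\<lambda>x y. tensor3 scale x y b) (\<Delta> a) = sw (\<lambda>x y. tensor3 scale x y b) a" for a b
    by (rule lift2_comult) (intro lin)
  then show ?thesis unfolding comult_id_def by simp (rule lift2_comult, intro lin)
qed

lemma id_comult_sw:
  "id_comult scale \<Delta> (\<Delta> h) = sw (\<lambda>a b. sw (\<lambda>x y. tensor3 scale a x y) b) h"
proof -
  have "lift2 scale fun_scale (\<lambda>x y. tensor3 scale b x y) (\<Delta> a) = sw (\<lambda>x y. tensor3 scale b x y) a" for a b
    by (rule lift2_comult) (intro lin)
  then show ?thesis unfolding id_comult_def by simp (rule lift2_comult, intro lin)
qed

lemma tensor2_mult_sw:
  "tensor2_mult scale (\<Delta> h) (\<Delta> g) = sw (\<lambda>a b. sw (\<lambda>c d. tensor2 scale (a * c) (b * d)) g) h"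
proof -
  have "lift2 scale fun_scale (\<lambda>c d. tensor2 scale (a * c) (b * d)) (\<Delta> g) = sw (\<lambda>c d. tensor2 scale (a * c) (b * d)) g" for a b
    by (rule lift2_comult) (intro lin)
  then show ?thesis unfolding tensor2_mult_def by simp (rule lift2_comult, intro lin)
qed

lemma tensor2_mult_pure:
  "tensor2_mult scale (\<Delta> h) (tensor2 scale x y) = sw (\<lambda>a b. tensor2 scale (a * x) (b * y)) h"
  "tensor2_mult scale (tensor2 scale x y) (\<Delta> h) = sw (\<lambda>a b. tensor2 scale (x * a) (y * b)) h"
proof -
  have "lift2 scale fun_scale (\<lambda>c d. tensor2 scale (a * c) (b * d)) (tensor2 scale x y) = tensor2 scale (a * x) (b * y)" for a b
    by (rule lift2(2)) (intro lin)
  then show "tensor2_mult scale (\<Delta> h) (tensor2 scale x y) = sw (\<lambda>a b. tensor2 scale (a * x) (b * y)) h"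
    unfolding tensor2_mult_def by simp (rule lift2_comult, intro lin)
  have "lift2 scale fun_scale (\<lambda>c d. tensor2 scale (a * c) (b * d)) (\<Delta> h) = sw (\<lambda>c d. tensor2 scale (a * c) (b * d)) h" for a b
    by (rule lift2_comult) (intro lin)
  then show "tensor2_mult scale (tensor2 scale x y) (\<Delta> h) = sw (\<lambda>a b. tensor2 scale (x * a) (y * b)) h"
    unfolding tensor2_mult_def by simp (rule lift2(2), intro lin)
qed

lemma lift2_sw:
  "bilinear_map scale sW f \<Longrightarrow>
    lift2 scale sW f (sw (\<lambda>a b. tensor2 scale (g a b) (k a b)) h) = sw (\<lambda>a b. f (g a b) (k a b)) h"
  unfolding sw_def by (rule lift2_sum_pairs)

lemma lift3_sw_sw:
  assumes "trilinear_map scale sW f"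
  shows "lift3 scale sW f (sw (\<lambda>a b. sw (\<lambda>c d. tensor3 scale (u a b c d) (v a b c d) (w a b c d)) (g a b)) h)
    = sw (\<lambda>a b. sw (\<lambda>c d. f (u a b c d) (v a b c d) (w a b c d)) (g a b)) h"
  by (simp add: linear_sw[OF lift3(1)[OF assms]] lift3(2)[OF assms])

lemma tensor_one_sw: "tensor_one scale (\<Delta> h) = sw (\<lambda>a b. tensor3 scale a b 1) h"
  unfolding tensor_one_def by (rule lift2_comult, intro lin)

lemma one_tensor_sw: "one_tensor scale (\<Delta> h) = sw (\<lambda>a b. tensor3 scale 1 a b) h"
  unfolding one_tensor_def by (rule lift2_comult, intro lin)

lemma tensor3_mult_sw:
  "tensor3_mult scale (sw (\<lambda>a b. tensor3 scale (u a b) (v a b) (w a b)) h)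
     (sw (\<lambda>a b. tensor3 scale (u' a b) (v' a b) (w' a b)) g)
   = sw (\<lambda>a b. sw (\<lambda>c d. tensor3 scale (u a b * u' c d) (v a b * v' c d) (w a b * w' c d)) g) h"
proof -
  have "lift3 scale fun_scale (\<lambda>x y z. tensor3 scale (a * x) (b * y) (c * z))
      (sw (\<lambda>a b. tensor3 scale (u' a b) (v' a b) (w' a b)) g)
    = sw (\<lambda>c' d. tensor3 scale (a * u' c' d) (b * v' c' d) (c * w' c' d)) g" for a b c
    unfolding sw_def by (rule lift3_sum_pairs) (intro lin)
  then show ?thesis unfolding tensor3_mult_def
    by simp (unfold sw_def, rule lift3_sum_pairs, fold sw_def, intro lin)
qed

text \<open>
  The equivalence serves both ways: left to right it yields the rewrite rules of the calculus, and
  right to left it reduces the axioms of a deformation to identities of Sweedler sums.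
\<close>

lemma weak_hopf_algebra_iff:
  "weak_hopf_algebra scale \<Delta> \<epsilon> S \<longleftrightarrow>
    (\<forall>h. sw (\<lambda>a b. sw (\<lambda>x y. tensor3 scale x y b) a) h = sw (\<lambda>a b. sw (\<lambda>x y. tensor3 scale a x y) b) h) \<and>
    (\<forall>h. sw (\<lambda>a b. scale (\<epsilon> a) b) h = h) \<and>
    (\<forall>h. sw (\<lambda>a b. scale (\<epsilon> b) a) h = h) \<and>
    (\<forall>h g. sw (tensor2 scale) (h * g) = sw (\<lambda>a b. sw (\<lambda>c d. tensor2 scale (a * c) (b * d)) g) h) \<and>
    sw (\<lambda>a b. sw (\<lambda>x y. tensor3 scale x y b) a) 1 = sw (\<lambda>a b. sw (\<lambda>c d. tensor3 scale a (b * c) d) 1) 1 \<and>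
    sw (\<lambda>a b. sw (\<lambda>x y. tensor3 scale x y b) a) 1 = sw (\<lambda>c d. sw (\<lambda>a b. tensor3 scale a (c * b) d) 1) 1 \<and>
    (\<forall>f g h. \<epsilon> (f * g * h) = sw (\<lambda>a b. \<epsilon> (f * a) * \<epsilon> (b * h)) g) \<and>
    (\<forall>f g h. \<epsilon> (f * g * h) = sw (\<lambda>a b. \<epsilon> (f * b) * \<epsilon> (a * h)) g) \<and>
    (\<forall>h. sw (\<lambda>a b. a * S b) h = sw (\<lambda>a b. scale (\<epsilon> (a * h)) b) 1) \<and>
    (\<forall>h. sw (\<lambda>a b. S a * b) h = sw (\<lambda>a b. scale (\<epsilon> (h * b)) a) 1) \<and>
    (\<forall>h. S h = sw (\<lambda>a b. sw (\<lambda>x y. S x * y * S b) a) h)"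
proof -
  have t: "trilinear_map scale scale (\<lambda>a b c. S a * b * S c)" by (intro lin)
  have b: "bilinear_map scale scale (\<lambda>a b. scale (\<epsilon> a) b)" "bilinear_map scale scale (\<lambda>a b. scale (\<epsilon> b) a)"
    "bilinear_map scale scale (\<lambda>a b. a * S b)" "bilinear_map scale scale (\<lambda>a b. S a * b)"
    "bilinear_map scale (*) (\<lambda>a b. \<epsilon> (f * a) * \<epsilon> (b * h))"
    "bilinear_map scale (*) (\<lambda>a b. \<epsilon> (f * b) * \<epsilon> (a * h))" for f h
    by (intro lin)+
  show ?thesis
    unfolding weak_hopf_algebra_def weak_hopf_algebra_axioms_def comult_id_sw id_comult_sw
      tensor2_mult_sw tensor2_mult_pure tensor_one_sw one_tensor_sw tensor3_mult_sw lift3_sw_sw[OF t]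
      lift2_sw[OF b(1)] lift2_sw[OF b(2)] b[THEN lift2_comult]
    by (simp add: unital_algebra_axioms comult_lin counit_lin antipode_lin sum_pairs_in_tensor2_space
        comult_eq[of h for h, folded sw_def] sw_def[symmetric]
        sum_pairs_in_tensor2_space[of scale "D h" for h, folded sw_def])
qed

end

section \<open>The bases and the antipode\<close>

locale sweedler_wha = sweedler scale \<Delta> D \<epsilon> S + weak_hopf_algebra scale \<Delta> \<epsilon> S
  for scale :: "'k::field \<Rightarrow> 'a::{ring, monoid_mult} \<Rightarrow> 'a" and \<Delta> D \<epsilon> S
begin

lemma sw_cong:
  assumes "\<And>a b. f a b = g a b"
  shows "sw f h = sw g h"
proof -
  have "f = g" by (intro ext assms)
  then show ?thesis by simp
qed

lemmas wha_sw = weak_hopf_algebra_axioms[unfolded weak_hopf_algebra_iff]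

text \<open>
  The equations in the tensor square and cube are transported along the universal property, so that they hold
  for arbitrary multilinear maps.
\<close>

lemma sw_coassoc:
  assumes "trilinear_map scale sW \<tau>"
  shows "sw (\<lambda>a b. sw (\<lambda>x y. \<tau> x y b) a) h = sw (\<lambda>a b. sw (\<lambda>x y. \<tau> a x y) b) h"
proof -
  have "lift3 scale sW \<tau> (sw (\<lambda>a b. sw (\<lambda>x y. tensor3 scale x y b) a) h)
    = lift3 scale sW \<tau> (sw (\<lambda>a b. sw (\<lambda>x y. tensor3 scale a x y) b) h)"
    using wha_sw by metis
  then show ?thesis by (simp only: lift3_sw_sw[OF assms])
qed

lemma sw_one_left:
  assumes "trilinear_map scale sW \<tau>"
  shows "sw (\<lambda>a b. sw (\<lambda>x y. \<tau> x y b) a) 1 = sw (\<lambda>a b. sw (\<lambda>c d. \<tau> a (b * c) d) 1) 1"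
proof -
  have "lift3 scale sW \<tau> (sw (\<lambda>a b. sw (\<lambda>x y. tensor3 scale x y b) a) 1)
    = lift3 scale sW \<tau> (sw (\<lambda>a b. sw (\<lambda>c d. tensor3 scale a (b * c) d) 1) 1)"
    using wha_sw by metis
  then show ?thesis by (simp only: lift3_sw_sw[OF assms])
qed

lemma sw_one_right:
  assumes "trilinear_map scale sW \<tau>"
  shows "sw (\<lambda>a b. sw (\<lambda>x y. \<tau> x y b) a) 1 = sw (\<lambda>c d. sw (\<lambda>a b. \<tau> a (c * b) d) 1) 1"
proof -
  have "lift3 scale sW \<tau> (sw (\<lambda>a b. sw (\<lambda>x y. tensor3 scale x y b) a) 1)
    = lift3 scale sW \<tau> (sw (\<lambda>c d. sw (\<lambda>a b. tensor3 scale a (c * b) d) 1) 1)"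
    using wha_sw by metis
  then show ?thesis by (simp only: lift3_sw_sw[OF assms])
qed

lemma sw_mult:
  assumes "bilinear_map scale sW \<beta>"
  shows "sw \<beta> (h * g) = sw (\<lambda>a b. sw (\<lambda>c d. \<beta> (a * c) (b * d)) g) h"
proof -
  have "lift2 scale sW \<beta> (sw (tensor2 scale) (h * g))
    = lift2 scale sW \<beta> (sw (\<lambda>a b. sw (\<lambda>c d. tensor2 scale (a * c) (b * d)) g) h)"
    using wha_sw by metis
  then show ?thesis by (simp only: linear_sw[OF lift2(1)[OF assms]] lift2(2)[OF assms])
qed

lemma sw_counit_left:
  assumes F: "Vector_Spaces.linear scale sW F"
  shows "sw (\<lambda>a b. sW (\<epsilon> a) (F b)) h = F h"
proof -
  interpret F: Vector_Spaces.linear scale sW F by fact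
  have "h = sw (\<lambda>a b. scale (\<epsilon> a) b) h" using wha_sw by metis
  then have "F h = F (sw (\<lambda>a b. scale (\<epsilon> a) b) h)" by simp
  then show ?thesis by (simp add: linear_sw[OF F] F.scale)
qed

lemma sw_counit_right:
  assumes F: "Vector_Spaces.linear scale sW F"
  shows "sw (\<lambda>a b. sW (\<epsilon> b) (F a)) h = F h"
proof -
  interpret F: Vector_Spaces.linear scale sW F by fact
  have "h = sw (\<lambda>a b. scale (\<epsilon> b) a) h" using wha_sw by metis
  then have "F h = F (sw (\<lambda>a b. scale (\<epsilon> b) a) h)" by simp
  then show ?thesis by (simp add: linear_sw[OF F] F.scale)
qed

lemma counit_12: "\<epsilon> (f * g * h) = sw (\<lambda>a b. \<epsilon> (f * a) * \<epsilon> (b * h)) g"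
  using wha_sw by metis

lemma counit_21: "\<epsilon> (f * g * h) = sw (\<lambda>a b. \<epsilon> (f * b) * \<epsilon> (a * h)) g"
  using wha_sw by metis

abbreviation et where "et \<equiv> counital_t scale \<Delta> \<epsilon>"
abbreviation es where "es \<equiv> counital_s scale \<Delta> \<epsilon>"
abbreviation Ht where "Ht \<equiv> target_base scale \<Delta> \<epsilon>"
abbreviation Hs where "Hs \<equiv> source_base scale \<Delta> \<epsilon>"

lemma et_sw: "et h = sw (\<lambda>a b. scale (\<epsilon> (a * h)) b) 1"
  unfolding counital_t_def by (rule lift2_comult, intro lin)

lemma es_sw: "es h = sw (\<lambda>a b. scale (\<epsilon> (h * b)) a) 1"
  unfolding counital_s_def by (rule lift2_comult, intro lin)

lemma antipode_et: "sw (\<lambda>a b. a * S b) h = et h"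
  unfolding et_sw using wha_sw by metis

lemma antipode_es: "sw (\<lambda>a b. S a * b) h = es h"
  unfolding es_sw using wha_sw by metis

lemma antipode_antipode: "S h = sw (\<lambda>a b. sw (\<lambda>x y. S x * y * S b) a) h"
  using wha_sw by metis

lemma et_lin: "Vector_Spaces.linear s scale F \<Longrightarrow> Vector_Spaces.linear s scale (\<lambda>x. et (F x))"
  unfolding antipode_et[symmetric] by (intro lin)

lemma es_lin: "Vector_Spaces.linear s scale F \<Longrightarrow> Vector_Spaces.linear s scale (\<lambda>x. es (F x))"
  unfolding antipode_es[symmetric] by (intro lin)

lemmas lins = lin et_lin es_lin

lemma lin_W:
  assumes "bilinear_map scale sW \<beta>"
  shows "Vector_Spaces.linear s scale F \<Longrightarrow> Vector_Spaces.linear s sW (\<lambda>x. \<beta> (F x) b)"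
    "Vector_Spaces.linear s scale F \<Longrightarrow> Vector_Spaces.linear s sW (\<lambda>x. \<beta> a (F x))"
    "Vector_Spaces.linear s (*) F' \<Longrightarrow> Vector_Spaces.linear s sW (\<lambda>x. sW (F' x) v)"
    "Vector_Spaces.linear s sW G \<Longrightarrow> Vector_Spaces.linear s sW (\<lambda>x. sW c (G x))"
  by (rule bilinear_linear[OF assms] linear_scalar_intro[OF bilinear_cod[OF assms]]
      linear_const_scale_intro; assumption)+

lemma et_1 [simp]: "et 1 = 1" and es_1 [simp]: "es 1 = 1"
  unfolding et_sw es_sw using wha_sw by auto

lemma one_in_bases: "1 \<in> Ht" "1 \<in> Hs"
  unfolding target_base_def source_base_def using et_1 es_1 by (metis rangeI)+

text \<open>
  Expansions of a counital map inside a bilinear expression, which make it accessible to the axioms for \<open>\<Delta> 1\<close>.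
\<close>

lemma sw_bil_et:
  assumes B: "bilinear_map scale sW \<beta>"
  shows "\<beta> u (et h) = sw (\<lambda>a b. sW (\<epsilon> (a * h)) (\<beta> u b)) 1"
    and "\<beta> (et h) u = sw (\<lambda>a b. sW (\<epsilon> (a * h)) (\<beta> b u)) 1"
proof -
  have l: "Vector_Spaces.linear scale sW (\<lambda>x. \<beta> u x)" "Vector_Spaces.linear scale sW (\<lambda>x. \<beta> x u)"
    by (intro lins lin_W[OF B])+
  show "\<beta> u (et h) = sw (\<lambda>a b. sW (\<epsilon> (a * h)) (\<beta> u b)) 1"
    "\<beta> (et h) u = sw (\<lambda>a b. sW (\<epsilon> (a * h)) (\<beta> b u)) 1"
    unfolding et_sw linear_sw[OF l(1)] linear_sw[OF l(2)] by (simp_all add: bilinear_map_add_scale[OF B])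
qed

lemma sw_bil_es:
  assumes B: "bilinear_map scale sW \<beta>"
  shows "\<beta> u (es h) = sw (\<lambda>a b. sW (\<epsilon> (h * b)) (\<beta> u a)) 1"
    and "\<beta> (es h) u = sw (\<lambda>a b. sW (\<epsilon> (h * b)) (\<beta> a u)) 1"
proof -
  have l: "Vector_Spaces.linear scale sW (\<lambda>x. \<beta> u x)" "Vector_Spaces.linear scale sW (\<lambda>x. \<beta> x u)"
    by (intro lins lin_W[OF B])+
  show "\<beta> u (es h) = sw (\<lambda>a b. sW (\<epsilon> (h * b)) (\<beta> u a)) 1"
    "\<beta> (es h) u = sw (\<lambda>a b. sW (\<epsilon> (h * b)) (\<beta> a u)) 1"
    unfolding es_sw linear_sw[OF l(1)] linear_sw[OF l(2)] by (simp_all add: bilinear_map_add_scale[OF B])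
qed

text \<open>
  \<open>\<Delta>(1)\<close> lies in \<open>H\<^sub>s \<otimes> H\<^sub>t\<close>, in the form of two projection rules.
\<close>

lemma one_et:
  assumes B: "bilinear_map scale sW \<beta>"
  shows "sw (\<lambda>a b. \<beta> a (et b)) 1 = sw \<beta> 1"
proof -
  have "sw (\<lambda>a b. \<beta> a (et b)) 1 = sw (\<lambda>a b. sw (\<lambda>c d. sW (\<epsilon> (c * b)) (\<beta> a d)) 1) 1"
    by (simp only: sw_bil_et(1)[OF B])
  also have "\<dots> = sw (\<lambda>c d. sw (\<lambda>a b. sW (\<epsilon> (c * b)) (\<beta> a d)) 1) 1" by (rule sw_swap)
  also have "\<dots> = sw (\<lambda>a b. sw (\<lambda>x y. sW (\<epsilon> y) (\<beta> x b)) a) 1"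
    by (rule sw_one_right[where sW = sW, symmetric]) (intro lins lin_W[OF B])
  also have "\<dots> = sw (\<lambda>a b. \<beta> a b) 1"
    by (rule sw_cong, rule sw_counit_right[where sW = sW]) (intro lins lin_W[OF B])
  finally show ?thesis .
qed

lemma one_es:
  assumes B: "bilinear_map scale sW \<beta>"
  shows "sw (\<lambda>a b. \<beta> (es a) b) 1 = sw \<beta> 1"
proof -
  have "sw (\<lambda>a b. \<beta> (es a) b) 1 = sw (\<lambda>a b. sw (\<lambda>c d. sW (\<epsilon> (a * d)) (\<beta> c b)) 1) 1"
    by (simp only: sw_bil_es(2)[OF B])
  also have "\<dots> = sw (\<lambda>a b. sw (\<lambda>x y. sW (\<epsilon> y) (\<beta> x b)) a) 1"
    by (rule sw_one_right[where sW = sW, symmetric]) (intro lins lin_W[OF B])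
  also have "\<dots> = sw (\<lambda>a b. \<beta> a b) 1"
    by (rule sw_cong, rule sw_counit_right[where sW = sW]) (intro lins lin_W[OF B])
  finally show ?thesis .
qed

text \<open>
  The comultiplication on the bases: \<open>\<Delta>(z) = (z \<otimes> 1)\<Delta>(1) = \<Delta>(1)(z \<otimes> 1)\<close> for \<open>z\<close> in \<open>H\<^sub>t\<close>, and symmetrically on \<open>H\<^sub>s\<close>.
  The two sides come from the two axioms for \<open>(\<Delta> \<otimes> id)\<Delta>(1)\<close>.
\<close>

lemma sw_et:
  assumes B: "bilinear_map scale sW \<beta>"
  shows "sw \<beta> (et h) = sw (\<lambda>a b. \<beta> (et h * a) b) 1" and "sw \<beta> (et h) = sw (\<lambda>a b. \<beta> (a * et h) b) 1"
proof -
  interpret W: vector_space sW by (rule bilinear_cod[OF B])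
  have l: "Vector_Spaces.linear scale sW (\<lambda>x. sw \<beta> x)" by (intro lins B)
  interpret l: Vector_Spaces.linear scale sW "\<lambda>x. sw \<beta> x" by (rule l)
  have sc: "sW r (sw f g) = sw (\<lambda>x y. sW r (f x y)) g" for r f g
    by (rule linear_sw[of sW sW]) (rule W.linear_scale_self)
  have "sw \<beta> (et h) = sw (\<lambda>c d. sw (\<lambda>x y. sW (\<epsilon> (c * h)) (\<beta> x y)) d) 1"
    unfolding et_sw linear_sw[OF l] l.scale sc ..
  also have "\<dots> = sw (\<lambda>a b. sw (\<lambda>x y. sW (\<epsilon> (x * h)) (\<beta> y b)) a) 1"
    by (rule sw_coassoc[where sW = sW, symmetric]) (intro lins lin_W[OF B])
  finally have *: "sw \<beta> (et h) = \<dots>" .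
  also have "\<dots> = sw (\<lambda>a b. sw (\<lambda>c d. sW (\<epsilon> (a * h)) (\<beta> (b * c) d)) 1) 1"
    by (rule sw_one_left[where sW = sW]) (intro lins lin_W[OF B])
  also have "\<dots> = sw (\<lambda>c d. sw (\<lambda>a b. sW (\<epsilon> (a * h)) (\<beta> (b * c) d)) 1) 1" by (rule sw_swap)
  also have "\<dots> = sw (\<lambda>c d. \<beta> (et h * c) d) 1"
    by (rule sw_cong, rule sw_bil_et(2)[symmetric]) (intro lins lin_W[OF B])
  finally show "sw \<beta> (et h) = sw (\<lambda>c d. \<beta> (et h * c) d) 1" .
  note *
  also have "sw (\<lambda>a b. sw (\<lambda>x y. sW (\<epsilon> (x * h)) (\<beta> y b)) a) 1
      = sw (\<lambda>c d. sw (\<lambda>a b. sW (\<epsilon> (a * h)) (\<beta> (c * b) d)) 1) 1"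
    by (rule sw_one_right[where sW = sW]) (intro lins lin_W[OF B])
  also have "\<dots> = sw (\<lambda>c d. \<beta> (c * et h) d) 1"
    by (rule sw_cong, rule sw_bil_et(2)[symmetric]) (intro lins lin_W[OF B])
  finally show "sw \<beta> (et h) = sw (\<lambda>c d. \<beta> (c * et h) d) 1" .
qed

lemma sw_es:
  assumes B: "bilinear_map scale sW \<beta>"
  shows "sw \<beta> (es h) = sw (\<lambda>a b. \<beta> a (es h * b)) 1" and "sw \<beta> (es h) = sw (\<lambda>a b. \<beta> a (b * es h)) 1"
proof -
  interpret W: vector_space sW by (rule bilinear_cod[OF B])
  have l: "Vector_Spaces.linear scale sW (\<lambda>x. sw \<beta> x)" by (intro lins B)
  interpret l: Vector_Spaces.linear scale sW "\<lambda>x. sw \<beta> x" by (rule l)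
  have sc: "sW r (sw f g) = sw (\<lambda>x y. sW r (f x y)) g" for r f g
    by (rule linear_sw[of sW sW]) (rule W.linear_scale_self)
  have *: "sw \<beta> (es h) = sw (\<lambda>c d. sw (\<lambda>x y. sW (\<epsilon> (h * d)) (\<beta> x y)) c) 1"
    unfolding es_sw linear_sw[OF l] l.scale sc ..
  also have "\<dots> = sw (\<lambda>a b. sw (\<lambda>c d. sW (\<epsilon> (h * d)) (\<beta> a (b * c))) 1) 1"
    by (rule sw_one_left[where sW = sW]) (intro lins lin_W[OF B])
  also have "\<dots> = sw (\<lambda>a b. \<beta> a (b * es h)) 1"
    by (rule sw_cong, rule sw_bil_es(1)[symmetric]) (intro lins lin_W[OF B])
  finally show "sw \<beta> (es h) = sw (\<lambda>c d. \<beta> c (d * es h)) 1" .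
  note *
  also have "sw (\<lambda>c d. sw (\<lambda>x y. sW (\<epsilon> (h * d)) (\<beta> x y)) c) 1
      = sw (\<lambda>c d. sw (\<lambda>a b. sW (\<epsilon> (h * d)) (\<beta> a (c * b))) 1) 1"
    by (rule sw_one_right[where sW = sW]) (intro lins lin_W[OF B])
  also have "\<dots> = sw (\<lambda>a b. sw (\<lambda>c d. sW (\<epsilon> (h * d)) (\<beta> a (c * b))) 1) 1" by (rule sw_swap)
  also have "\<dots> = sw (\<lambda>a b. \<beta> a (es h * b)) 1"
    by (rule sw_cong, rule sw_bil_es(1)[symmetric]) (intro lins lin_W[OF B])
  finally show "sw \<beta> (es h) = sw (\<lambda>c d. \<beta> c (es h * d)) 1" .
qed

text \<open>
  Apply \<open>id \<otimes> \<epsilon>(h _)\<close> to \<open>(z \<otimes> 1)\<Delta>(1) = \<Delta>(1)(z \<otimes> 1)\<close>.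
\<close>

lemma et_es_commute: "et g * es h = es h * et g"
proof -
  have B: "bilinear_map scale scale (\<lambda>a b. scale (\<epsilon> (h * b)) a)" by (intro lins)
  have "et g * es h = sw (\<lambda>a b. scale (\<epsilon> (h * b)) (et g * a)) 1"
    unfolding es_sw mult_sw by (simp only: scale_mult_right)
  also have "\<dots> = sw (\<lambda>a b. scale (\<epsilon> (h * b)) (a * et g)) 1"
    using sw_et[OF B] by metis
  also have "\<dots> = es h * et g"
    unfolding es_sw mult_sw by (simp only: scale_mult_left)
  finally show ?thesis .
qed

lemma et_I:
  assumes "sw (\<lambda>a b. scale (\<epsilon> a) b) x = sw (\<lambda>a b. scale (\<epsilon> (a * x)) b) 1"
  shows "et x = x" 
  using assms wha_sw unfolding et_sw by metis

lemma et_et: "et (et h) = et h"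
proof (rule et_I, rule sw_et(2))
  show "bilinear_map scale scale (\<lambda>a b. scale (\<epsilon> a) b)" by (intro lins)
qed

lemma Ht_iff: "z \<in> Ht \<longleftrightarrow> et z = z"
  unfolding target_base_def using et_et by (metis rangeE rangeI)

lemma es_es: "es (es h) = es h"
proof -
  have "bilinear_map scale scale (\<lambda>a b. scale (\<epsilon> b) a)" by (intro lins)
  from sw_es(1)[OF this] show ?thesis
    using wha_sw unfolding es_sw[of "es h"] by metis
qed

lemma Hs_iff: "y \<in> Hs \<longleftrightarrow> es y = y"
  unfolding source_base_def using es_es by (metis rangeE rangeI)

lemma et_in [simp]: "et h \<in> Ht" and es_in [simp]: "es h \<in> Hs"
  by (simp_all add: Ht_iff Hs_iff et_et es_es)

lemma Ht_Hs_commute: "z \<in> Ht \<Longrightarrow> y \<in> Hs \<Longrightarrow> z * y = y * z"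
  using et_es_commute by (metis Ht_iff Hs_iff)

lemma counit_mult_et: "\<epsilon> (g * et h) = \<epsilon> (g * h)"
proof -
  have B: "bilinear_map scale (*) (\<lambda>a b. \<epsilon> (a * b))" by (intro lins)
  show ?thesis using sw_bil_et(1)[OF B, of g h] counit_21[of g 1 h] by (simp add: mult.commute)
qed

lemma counit_es_mult: "\<epsilon> (es g * h) = \<epsilon> (g * h)"
proof -
  have B: "bilinear_map scale (*) (\<lambda>a b. \<epsilon> (a * b))" by (intro lins)
  show ?thesis using sw_bil_es(2)[OF B, of g h] counit_21[of g 1 h] by simp
qed

lemma et_mult_et: "et (g * et h) = et (g * h)"
  unfolding et_sw[of "g * et h"] et_sw[of "g * h"]
  using counit_mult_et by (metis mult.assoc)

lemma es_es_mult: "es (es g * h) = es (g * h)"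
  unfolding es_sw[of "es g * h"] es_sw[of "g * h"]
  using counit_es_mult by (metis mult.assoc)

lemma sw_mult_Ht:
  assumes B: "bilinear_map scale sW \<beta>" and z: "z \<in> Ht"
  shows "sw \<beta> (h * z) = sw (\<lambda>a b. \<beta> (a * z) b) h" "sw \<beta> (z * h) = sw (\<lambda>a b. \<beta> (z * a) b) h"
proof -
  have z': "et z = z" using z by (simp add: Ht_iff)
  have "sw \<beta> (h * z) = sw (\<lambda>a b. sw (\<lambda>c d. \<beta> (a * c) (b * d)) z) h" by (rule sw_mult[OF B])
  also have "\<dots> = sw (\<lambda>a b. sw (\<lambda>c d. \<beta> (a * (c * z)) (b * d)) 1) h"
    by (rule sw_cong, rule sw_et(2)[of sW _ z, unfolded z']) (intro lins lin_W[OF B])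
  also have "\<dots> = sw (\<lambda>a b. sw (\<lambda>c d. \<beta> (a * c * z) (b * d)) 1) h" by (simp only: mult.assoc)
  also have "\<dots> = sw (\<lambda>a b. \<beta> (a * z) b) (h * 1)"
    by (rule sw_mult[where sW = sW, symmetric]) (intro lins lin_W[OF B])
  finally show "sw \<beta> (h * z) = sw (\<lambda>a b. \<beta> (a * z) b) h" by simp
  have "sw \<beta> (z * h) = sw (\<lambda>a b. sw (\<lambda>c d. \<beta> (a * c) (b * d)) h) z" by (rule sw_mult[OF B])
  also have "\<dots> = sw (\<lambda>a b. sw (\<lambda>c d. \<beta> (z * a * c) (b * d)) h) 1"
    by (rule sw_et(1)[of sW _ z, unfolded z']) (intro lins lin_W[OF B])
  also have "\<dots> = sw (\<lambda>a b. sw (\<lambda>c d. \<beta> (z * (a * c)) (b * d)) h) 1" by (simp only: mult.assoc)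
  also have "\<dots> = sw (\<lambda>a b. \<beta> (z * a) b) (1 * h)"
    by (rule sw_mult[where sW = sW, symmetric]) (intro lins lin_W[OF B])
  finally show "sw \<beta> (z * h) = sw (\<lambda>a b. \<beta> (z * a) b) h" by simp
qed

lemma sw_mult_Hs:
  assumes B: "bilinear_map scale sW \<beta>" and y: "y \<in> Hs"
  shows "sw \<beta> (h * y) = sw (\<lambda>a b. \<beta> a (b * y)) h" "sw \<beta> (y * h) = sw (\<lambda>a b. \<beta> a (y * b)) h"
proof -
  have y': "es y = y" using y by (simp add: Hs_iff)
  have "sw \<beta> (h * y) = sw (\<lambda>a b. sw (\<lambda>c d. \<beta> (a * c) (b * d)) y) h" by (rule sw_mult[OF B])
  also have "\<dots> = sw (\<lambda>a b. sw (\<lambda>c d. \<beta> (a * c) (b * (d * y))) 1) h"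
    by (rule sw_cong, rule sw_es(2)[of sW _ y, unfolded y']) (intro lins lin_W[OF B])
  also have "\<dots> = sw (\<lambda>a b. sw (\<lambda>c d. \<beta> (a * c) (b * d * y)) 1) h" by (simp only: mult.assoc)
  also have "\<dots> = sw (\<lambda>a b. \<beta> a (b * y)) (h * 1)"
    by (rule sw_mult[where sW = sW, symmetric]) (intro lins lin_W[OF B])
  finally show "sw \<beta> (h * y) = sw (\<lambda>a b. \<beta> a (b * y)) h" by simp
  have "sw \<beta> (y * h) = sw (\<lambda>a b. sw (\<lambda>c d. \<beta> (a * c) (b * d)) h) y" by (rule sw_mult[OF B])
  also have "\<dots> = sw (\<lambda>a b. sw (\<lambda>c d. \<beta> (a * c) (y * b * d)) h) 1"
    by (rule sw_es(1)[of sW _ y, unfolded y']) (intro lins lin_W[OF B])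
  also have "\<dots> = sw (\<lambda>a b. sw (\<lambda>c d. \<beta> (a * c) (y * (b * d))) h) 1" by (simp only: mult.assoc)
  also have "\<dots> = sw (\<lambda>a b. \<beta> a (y * b)) (1 * h)"
    by (rule sw_mult[where sW = sW, symmetric]) (intro lins lin_W[OF B])
  finally show "sw \<beta> (y * h) = sw (\<lambda>a b. \<beta> a (y * b)) h" by simp
qed

lemma et_mult_Ht: "z \<in> Ht \<Longrightarrow> et (g * z) = sw (\<lambda>a b. a * z * S b) g"
  unfolding antipode_et[of "g * z", symmetric] by (rule sw_mult_Ht(1)[where sW = scale]) (intro lins)

lemma es_mult_Hs: "y \<in> Hs \<Longrightarrow> es (y * g) = sw (\<lambda>a b. S a * y * b) g"
  unfolding antipode_es[of "y * g", symmetric] mult.assoc by (rule sw_mult_Hs(2)[where sW = scale]) (intro lins)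

lemma Ht_mult: "z \<in> Ht \<Longrightarrow> w \<in> Ht \<Longrightarrow> z * w \<in> Ht"
proof -
  assume z: "z \<in> Ht" and w: "w \<in> Ht"
  have B: "bilinear_map scale scale (\<lambda>a b. scale (\<epsilon> a) b)" by (intro lins)
  have "sw (\<lambda>a b. scale (\<epsilon> a) b) (1 * z * w) = sw (\<lambda>a b. scale (\<epsilon> (a * w)) b) (1 * z)"
    by (rule sw_mult_Ht(1)[OF B w])
  also have "\<dots> = sw (\<lambda>a b. scale (\<epsilon> (a * z * w)) b) 1"
    by (rule sw_mult_Ht(1)[where sW = scale, OF _ z]) (intro lins)
  finally have "et (z * w) = z * w" by (intro et_I) (simp only: mult_1_left mult.assoc)
  then show "z * w \<in> Ht" by (simp add: Ht_iff)
qed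

text \<open>
  Since \<open>H\<^sub>t\<close> consists of the elements with \<open>\<Delta>(z) = \<Delta>(1)(z \<otimes> 1)\<close>, multiplying \<open>\<Delta>(p)\<Delta>(q) = \<Delta>(1)\<close> by \<open>p \<otimes> 1\<close> on the right shows that inverses
  stay in \<open>H\<^sub>t\<close>.
\<close>

lemma Ht_inverse:
  assumes q: "q \<in> Ht" and pq: "p * q = 1" "q * p = 1"
  shows "p \<in> Ht"
proof -
  have B: "bilinear_map scale scale (\<lambda>a b. scale (\<epsilon> (a * p)) b)" by (intro lins)
  have "sw (\<lambda>a b. scale (\<epsilon> (a * p)) b) (p * q) = sw (\<lambda>a b. scale (\<epsilon> (a * q * p)) b) p"
    by (rule sw_mult_Ht(1)[OF B q])
  then have "sw (\<lambda>a b. scale (\<epsilon> (a * p)) b) 1 = sw (\<lambda>a b. scale (\<epsilon> a) b) p"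
    by (simp only: mult.assoc pq mult_1_right)
  then have "et p = p" by (intro et_I) simp
  then show ?thesis by (simp add: Ht_iff)
qed

lemma S_et: "sw (\<lambda>a b. S a * et b) h = S h"
proof -
  have "sw (\<lambda>a b. S a * et b) h = sw (\<lambda>a b. sw (\<lambda>x y. S a * x * S y) b) h"
    by (simp only: antipode_et[symmetric] mult_sw mult.assoc)
  also have "\<dots> = sw (\<lambda>a b. sw (\<lambda>x y. S x * y * S b) a) h"
    by (rule sw_coassoc[where sW = scale, symmetric]) (intro lins)
  finally show ?thesis by (simp only: antipode_antipode[symmetric])
qed

lemma es_S: "sw (\<lambda>a b. es a * S b) h = S h"
  by (simp only: antipode_es[symmetric] mult_sw antipode_antipode[of h])

text \<open>
  As for Hopf algebras, \<open>S(g h)\<close> is expanded to \<open>S(g\<^sub>1 h\<^sub>1) g\<^sub>2 h\<^sub>2 S(h\<^sub>3) S(g\<^sub>3)\<close> and contracted from the left.  The inner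
  products do not collapse to scalars but to \<open>\<epsilon>\<^sub>t(h\<^sub>2)\<close> and \<open>\<epsilon>\<^sub>s(g\<^sub>1)\<close>; these
  commute, and are absorbed by \<open>S(h\<^sub>1) \<epsilon>\<^sub>t(h\<^sub>2) = S(h)\<close> and \<open>\<epsilon>\<^sub>s(g\<^sub>1) S(g\<^sub>2) = S(g)\<close>.
\<close>

lemma S_mult: "S (g * h) = S h * S g"
proof -
  have et_mult: "et (b * d) = sw (\<lambda>x y. x * et d * S y) b" for b d
    using et_mult_Ht[OF et_in, of b d] by (simp only: et_mult_et)
  have es_mult: "es (a * c) = sw (\<lambda>u v. S u * es a * v) c" for a c
    using es_mult_Hs[OF es_in, of a c] by (simp only: es_es_mult)
  have "S (g * h) = sw (\<lambda>a b. S a * et b) (g * h)" by (rule S_et[symmetric])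
  also have "\<dots> = sw (\<lambda>a b. sw (\<lambda>c d. S (a * c) * et (b * d)) h) g"
    by (rule sw_mult[where sW = scale]) (intro lins)
  also have "\<dots> = sw (\<lambda>a b. sw (\<lambda>c d. sw (\<lambda>x y. S (a * c) * (x * et d * S y)) b) h) g"
    by (simp only: et_mult mult_sw)
  also have "\<dots> = sw (\<lambda>a b. sw (\<lambda>x y. sw (\<lambda>c d. S (a * c) * (x * et d * S y)) h) b) g"
    by (rule sw_cong, rule sw_swap)
  also have "\<dots> = sw (\<lambda>a b. sw (\<lambda>x y. sw (\<lambda>c d. S (x * c) * (y * et d * S b)) h) a) g"
    by (rule sw_coassoc[where sW = scale, symmetric]) (intro lins)
  also have "\<dots> = sw (\<lambda>a b. sw (\<lambda>x y. sw (\<lambda>c d. sw (\<lambda>u v. S (x * c) * (y * (u * S v) * S b)) d) h) a) g"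
    by (simp only: antipode_et[symmetric] mult_sw)
  also have "\<dots> = sw (\<lambda>a b. sw (\<lambda>x y. sw (\<lambda>c d. sw (\<lambda>u v. S (x * u) * (y * (v * S d) * S b)) c) h) a) g"
    by (rule sw_cong, rule sw_cong, rule sw_coassoc[where sW = scale, symmetric]) (intro lins)
  also have "\<dots> = sw (\<lambda>a b. sw (\<lambda>c d. sw (\<lambda>x y. sw (\<lambda>u v. S (x * u) * (y * (v * S d) * S b)) c) a) h) g"
    by (rule sw_cong, rule sw_swap)
  also have "\<dots> = sw (\<lambda>a b. sw (\<lambda>c d. sw (\<lambda>x y. sw (\<lambda>u v. S (x * u) * (y * v)) c) a * S d * S b) h) g"
    by (simp only: mult_sw mult.assoc)
  also have "\<dots> = sw (\<lambda>a b. sw (\<lambda>c d. es (a * c) * S d * S b) h) g"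
  proof -
    have "sw (\<lambda>x y. sw (\<lambda>u v. S (x * u) * (y * v)) c) a = es (a * c)" for a c
      unfolding antipode_es[symmetric] by (rule sw_mult[where sW = scale, symmetric]) (intro lins)
    then show ?thesis by simp
  qed
  also have "\<dots> = sw (\<lambda>a b. sw (\<lambda>c d. sw (\<lambda>u v. S u * es a * v * S d * S b) c) h) g"
    by (simp only: es_mult mult_sw)
  also have "\<dots> = sw (\<lambda>a b. sw (\<lambda>c d. sw (\<lambda>u v. S c * es a * u * S v * S b) d) h) g"
    by (rule sw_cong, rule sw_coassoc[where sW = scale]) (intro lins)
  also have "\<dots> = sw (\<lambda>a b. sw (\<lambda>c d. S c * (es a * et d) * S b) h) g"
    by (simp only: antipode_et[symmetric] mult_sw mult.assoc)
  also have "\<dots> = sw (\<lambda>a b. sw (\<lambda>c d. (S c * et d) * (es a * S b)) h) g"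
    by (simp only: et_es_commute[symmetric] mult.assoc)
  also have "\<dots> = sw (\<lambda>c d. S c * et d) h * sw (\<lambda>a b. es a * S b) g"
    by (simp only: mult_sw)
  also have "\<dots> = S h * S g" by (simp only: S_et es_S)
  finally show ?thesis .
qed

text \<open>
  On the bases the antipode is a counital map, because \<open>\<epsilon>\<^sub>s(z) = S(1\<^sub>1 z) 1\<^sub>2 = S(z) S(1\<^sub>1) 1\<^sub>2\<close>.
\<close>

lemma S_Ht: assumes z: "z \<in> Ht" shows "S z = es z"
proof -
  have "es (1 * z) = sw (\<lambda>a b. S (a * z) * b) 1"
    unfolding antipode_es[of "1 * z", symmetric] by (rule sw_mult_Ht(1)[where sW = scale, OF _ z]) (intro lins)
  also have "\<dots> = S z * sw (\<lambda>a b. S a * b) 1" by (simp only: S_mult mult_sw mult.assoc)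
  finally show ?thesis by (simp add: antipode_es)
qed

lemma S_Hs: assumes y: "y \<in> Hs" shows "S y = et y"
proof -
  have "et (y * 1) = sw (\<lambda>a b. a * S (y * b)) 1"
    unfolding antipode_et[of "y * 1", symmetric] by (rule sw_mult_Hs(2)[where sW = scale, OF _ y]) (intro lins)
  also have "\<dots> = sw (\<lambda>a b. a * S b) 1 * S y" by (simp only: S_mult mult_sw mult.assoc)
  finally show ?thesis by (simp add: antipode_et)
qed

lemma S_Ht_in: "z \<in> Ht \<Longrightarrow> S z \<in> Hs" and S_Hs_in: "y \<in> Hs \<Longrightarrow> S y \<in> Ht"
  by (simp_all only: S_Ht S_Hs et_in es_in)

lemma S_1 [simp]: "S 1 = 1"
  by (simp only: S_Ht[OF one_in_bases(1)] es_1)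

text \<open>
  On \<open>\<Delta>(1)\<close> the antipode acts by \<open>\<epsilon>\<^sub>s\<close> and \<open>\<epsilon>\<^sub>t\<close>; expanding both introduces two further copies of \<open>\<Delta>(1)\<close>, and the axiom
  for \<open>\<epsilon>(e 1 d)\<close> eliminates the original one.
\<close>

lemma sw_flip:
  assumes B: "bilinear_map scale sW \<beta>"
  shows "sw (\<lambda>a b. \<beta> (S b) (S a)) 1 = sw \<beta> 1"
proof -
  interpret W: vector_space sW by (rule bilinear_cod[OF B])
  have sc: "sW r (sw f g) = sw (\<lambda>x y. sW r (f x y)) g" for r f g
    by (rule linear_sw[of sW sW]) (rule W.linear_scale_self)
  have "sw (\<lambda>a b. \<beta> (S b) (S a)) 1 = sw (\<lambda>a b. \<beta> (S (et b)) (S a)) 1"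
    by (rule one_et[where sW = sW, symmetric]) (intro lins lin_W[OF B])
  also have "\<dots> = sw (\<lambda>a b. \<beta> (S (et b)) (S (es a))) 1"
    by (rule one_es[where sW = sW, symmetric]) (intro lins lin_W[OF B])
  also have "\<dots> = sw (\<lambda>a b. \<beta> (es (et b)) (et (es a))) 1"
    by (simp only: S_Ht[OF et_in] S_Hs[OF es_in])
  also have "\<dots> = sw (\<lambda>a b. \<beta> (es (et b)) (et a)) 1"
    by (rule one_es[where sW = sW]) (intro lins lin_W[OF B])
  also have "\<dots> = sw (\<lambda>a b. \<beta> (es b) (et a)) 1"
    by (rule one_et[where sW = sW]) (intro lins lin_W[OF B])
  also have "\<dots> = sw (\<lambda>a b. sw (\<lambda>c d. sw (\<lambda>e f. sW (\<epsilon> (e * a) * \<epsilon> (b * d)) (\<beta> c f)) 1) 1) 1"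
    unfolding sw_bil_es(2)[OF B] by (simp only: sw_bil_et(1)[OF B] sc W.scale_scale mult.commute)
  also have "\<dots> = sw (\<lambda>c d. sw (\<lambda>a b. sw (\<lambda>e f. sW (\<epsilon> (e * a) * \<epsilon> (b * d)) (\<beta> c f)) 1) 1) 1"
    by (rule sw_swap)
  also have "\<dots> = sw (\<lambda>c d. sw (\<lambda>e f. sw (\<lambda>a b. sW (\<epsilon> (e * a) * \<epsilon> (b * d)) (\<beta> c f)) 1) 1) 1"
    by (rule sw_cong, rule sw_swap)
  also have "\<dots> = sw (\<lambda>c d. sw (\<lambda>e f. sW (\<epsilon> (e * d)) (\<beta> c f)) 1) 1"
  proof -
    have "sw (\<lambda>a b. sW (\<epsilon> (e * a) * \<epsilon> (b * d)) v) 1 = sW (\<epsilon> (e * d)) v" for e d v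
    proof -
      have l: "Vector_Spaces.linear (*) sW (\<lambda>x. sW x v)"
        by (rule linear_I[OF vector_space_mult W.vector_space_axioms])
          (simp_all add: W.scale_left_distrib)
      show ?thesis using linear_sw[OF l] counit_12[of e 1 d] by simp
    qed
    then show ?thesis by simp
  qed
  also have "\<dots> = sw (\<lambda>c d. \<beta> c (et d)) 1" by (simp only: sw_bil_et(1)[OF B])
  also have "\<dots> = sw \<beta> 1" by (rule one_et[OF B])
  finally show ?thesis .
qed

text \<open>
  Expand the right side as \<open>1\<^sub>1 h\<^sub>1 \<epsilon>(1\<^sub>2 h\<^sub>2) \<otimes> 1\<^sub>3\<close> and split the threefold \<open>\<Delta>(1)\<close> into two copies, one of which is absorbed into \<open>\<Delta>(h)\<close>.
\<close>

lemma comult_et: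
  assumes B: "bilinear_map scale sW \<beta>"
  shows "sw (\<lambda>a b. \<beta> a (et b)) h = sw (\<lambda>a b. \<beta> (a * h) b) 1"
proof -
  have "sw (\<lambda>a b. \<beta> (a * h) b) 1 = sw (\<lambda>a b. sw (\<lambda>x y. sW (\<epsilon> y) (\<beta> x b)) (a * h)) 1"
    by (rule sw_cong, rule sw_counit_right[where sW = sW, symmetric]) (intro lins lin_W[OF B])
  also have "\<dots> = sw (\<lambda>a b. sw (\<lambda>x y. sw (\<lambda>u v. sW (\<epsilon> (y * v)) (\<beta> (x * u) b)) h) a) 1"
    by (rule sw_cong, rule sw_mult[where sW = sW]) (intro lins lin_W[OF B])
  also have "\<dots> = sw (\<lambda>c d. sw (\<lambda>a b. sw (\<lambda>u v. sW (\<epsilon> (c * b * v)) (\<beta> (a * u) d)) h) 1) 1"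
    by (rule sw_one_right[where sW = sW]) (intro lins lin_W[OF B])
  also have "\<dots> = sw (\<lambda>c d. sw (\<lambda>a b. sw (\<lambda>u v. sW (\<epsilon> (c * (b * v))) (\<beta> (a * u) d)) h) 1) 1"
    by (simp only: mult.assoc)
  also have "\<dots> = sw (\<lambda>c d. sw (\<lambda>u v. sW (\<epsilon> (c * v)) (\<beta> u d)) (1 * h)) 1"
    by (rule sw_cong, rule sw_mult[where sW = sW, symmetric]) (intro lins lin_W[OF B])
  also have "\<dots> = sw (\<lambda>u v. sw (\<lambda>c d. sW (\<epsilon> (c * v)) (\<beta> u d)) 1) (1 * h)" by (rule sw_swap)
  also have "\<dots> = sw (\<lambda>a b. \<beta> a (et b)) h" by (simp add: sw_bil_et(1)[OF B])
  finally show ?thesis by simp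
qed

text \<open>
  Both sides equal \<open>y\<^sub>1 \<otimes> \<epsilon>\<^sub>t(y\<^sub>2)\<close>, using \<open>\<Delta>(y) = 1\<^sub>1 \<otimes> 1\<^sub>2 y\<close> and \<open>\<epsilon>\<^sub>t(1\<^sub>2 y) = \<epsilon>\<^sub>t(1\<^sub>2 S(y))\<close>.
  This relation carries both the multiplicativity of the deformed comultiplication and the separability of \<open>H\<^sub>t\<close>.
\<close>

lemma sw_one_Hs:
  assumes B: "bilinear_map scale sW \<beta>" and y: "y \<in> Hs"
  shows "sw (\<lambda>a b. \<beta> (a * y) b) 1 = sw (\<lambda>a b. \<beta> a (b * S y)) 1"
proof -
  have "sw (\<lambda>a b. \<beta> (a * y) b) 1 = sw (\<lambda>a b. \<beta> a (et b)) (1 * y)"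
    by (simp add: comult_et[OF B])
  also have "\<dots> = sw (\<lambda>a b. \<beta> a (et (b * y))) 1"
    by (rule sw_mult_Hs(1)[where sW = sW, OF _ y]) (intro lins lin_W[OF B])
  also have "\<dots> = sw (\<lambda>a b. \<beta> a (et (b * S y))) 1"
    by (simp only: S_Hs[OF y] et_mult_et)
  also have "\<dots> = sw (\<lambda>a b. \<beta> a (et (et b * S y))) 1"
    by (rule one_et[where sW = sW, symmetric]) (intro lins lin_W[OF B])
  also have "\<dots> = sw (\<lambda>a b. \<beta> a (et b * S y)) 1"
    using Ht_mult[OF et_in S_Hs_in[OF y]] by (simp add: Ht_iff)
  also have "\<dots> = sw (\<lambda>a b. \<beta> a (b * S y)) 1"
    by (rule one_et[where sW = sW]) (intro lins lin_W[OF B])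
  finally show ?thesis .
qed

end
section \<open>Deformation\<close>

lemma inverse_elem_eq:
  assumes "q * p = 1" "p * q = 1"
  shows "inverse_elem q = p"
  unfolding inverse_elem_def
proof (rule the_equality)
  fix y assume "q * y = 1 \<and> y * q = 1"
  then have "p * (q * y) = p" by simp
  then show "y = p" using assms by (simp add: mult.assoc[symmetric])
qed (use assms in simp)

locale deformation = sweedler_wha scale \<Delta> D \<epsilon> S
  for scale :: "'k::field \<Rightarrow> 'a::{ring, monoid_mult} \<Rightarrow> 'a" and \<Delta> D \<epsilon> S +
  fixes q p :: 'a
  assumes q_in: "q \<in> Ht" and qp: "q * p = 1" and pq: "p * q = 1"
    and q_cond: "sw (\<lambda>a b. S a * q * b) 1 = 1"
begin

lemma p_in: "p \<in> Ht"
  using Ht_inverse[OF q_in pq qp] .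

lemma cancel: "q * (p * x) = x" "p * (q * x) = x" "x * q * p = x" "x * p * q = x"
  by (simp_all add: mult.assoc[symmetric] qp pq) (simp_all add: mult.assoc qp pq)

text \<open>
  Moving \<open>1'\<^sub>1\<close> from the first to the second factor turns \<open>1\<^sub>1 1'\<^sub>1 \<otimes> 1\<^sub>2 q 1'\<^sub>2\<close> into \<open>1\<^sub>1 \<otimes> 1\<^sub>2 S(1'\<^sub>1) q 1'\<^sub>2\<close>.
\<close>

lemma sw_q_one:
  assumes B: "bilinear_map scale sW \<beta>"
  shows "sw (\<lambda>a b. sw (\<lambda>c d. \<beta> (a * c) (b * q * d)) 1) 1 = sw \<beta> 1"
proof -
  have l: "Vector_Spaces.linear scale sW (\<lambda>x. \<beta> a (b * x))" for a b by (intro lins lin_W[OF B])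
  have "sw (\<lambda>a b. sw (\<lambda>c d. \<beta> (a * c) (b * q * d)) 1) 1
    = sw (\<lambda>a b. sw (\<lambda>c d. \<beta> (a * es c) (b * q * d)) 1) 1"
    by (rule sw_cong, rule one_es[where sW = sW, symmetric]) (intro lins lin_W[OF B])
  also have "\<dots> = sw (\<lambda>c d. sw (\<lambda>a b. \<beta> (a * es c) (b * q * d)) 1) 1" by (rule sw_swap)
  also have "\<dots> = sw (\<lambda>c d. sw (\<lambda>a b. \<beta> a (b * S (es c) * q * d)) 1) 1"
    by (rule sw_cong, rule sw_one_Hs[where sW = sW, OF _ es_in]) (intro lins lin_W[OF B])
  also have "\<dots> = sw (\<lambda>c d. sw (\<lambda>a b. \<beta> a (b * S c * q * d)) 1) 1"
    by (rule one_es[where sW = sW]) (intro lins lin_W[OF B])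
  also have "\<dots> = sw (\<lambda>a b. sw (\<lambda>c d. \<beta> a (b * (S c * q * d))) 1) 1"
    by (subst sw_swap) (simp only: mult.assoc)
  also have "\<dots> = sw (\<lambda>a b. \<beta> a (b * 1)) 1"
    by (simp only: linear_sw[OF l, symmetric] q_cond)
  finally show ?thesis by simp
qed

lemma sw_q:
  assumes B: "bilinear_map scale sW \<beta>"
  shows "sw (\<lambda>a b. sw (\<lambda>c d. \<beta> (a * c) (b * q * d)) g) h = sw \<beta> (h * g)"
proof -
  have 1: "sw (\<lambda>a b. sw (\<lambda>c d. \<beta> (a * c) (b * q * d)) (1 * g)) (h * 1)
    = sw (\<lambda>a b. sw (\<lambda>x y. sw (\<lambda>c d. sw (\<lambda>u v. \<beta> (a * x * (c * u)) (b * y * q * (d * v))) g) 1) 1) h"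
  proof -
    have "sw (\<lambda>a b. sw (\<lambda>c d. \<beta> (a * c) (b * q * d)) (1 * g)) (h * 1)
      = sw (\<lambda>a b. sw (\<lambda>x y. sw (\<lambda>c d. \<beta> (a * x * c) (b * y * q * d)) (1 * g)) 1) h"
      by (rule sw_mult[where sW = sW]) (intro lins lin_W[OF B])
    also have "\<dots> = sw (\<lambda>a b. sw (\<lambda>x y. sw (\<lambda>c d. sw (\<lambda>u v. \<beta> (a * x * (c * u)) (b * y * q * (d * v))) g) 1) 1) h"
      by (rule sw_cong, rule sw_cong, rule sw_mult[where sW = sW]) (intro lins lin_W[OF B])
    finally show ?thesis .
  qed
  have 2: "sw (\<lambda>x y. sw (\<lambda>c d. sw (\<lambda>u v. \<beta> (a * x * (c * u)) (b * y * q * (d * v))) g) 1) 1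
    = sw (\<lambda>x y. sw (\<lambda>u v. \<beta> (a * (x * u)) (b * (y * v))) g) 1" for a b
    using sw_q_one[of sW "\<lambda>s t. sw (\<lambda>u v. \<beta> (a * (s * u)) (b * (t * v))) g"]
    by (simp only: mult.assoc) (rule meta_mp, assumption, intro lins lin_W[OF B])
  have 3: "sw (\<lambda>a b. sw (\<lambda>x y. sw (\<lambda>u v. \<beta> (a * (x * u)) (b * (y * v))) g) 1) h
    = sw (\<lambda>a b. sw (\<lambda>u v. \<beta> (a * u) (b * v)) (1 * g)) h"
    by (rule sw_cong, rule sw_mult[where sW = sW, symmetric]) (intro lins lin_W[OF B])
  have 4: "sw \<beta> (h * g) = sw (\<lambda>a b. sw (\<lambda>u v. \<beta> (a * u) (b * v)) (1 * g)) h"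
    using sw_mult[OF B, of h "1 * g"] by simp
  show ?thesis using 1 2 3 4 by simp
qed

text \<open>
  Write \<open>h = 1 h\<close>; antimultiplicativity then puts \<open>S(1\<^sub>1) q 1\<^sub>2\<close> in the middle.  The companion \<open>antipode_S_q\<close> uses \<open>h = h 1\<close>.
\<close>

lemma antipode_q: "sw (\<lambda>a b. S a * q * b) h = es h"
proof -
  have "sw (\<lambda>a b. S a * q * b) (1 * h) = sw (\<lambda>a b. sw (\<lambda>c d. S (a * c) * q * (b * d)) h) 1"
    by (rule sw_mult[where sW = scale]) (intro lins)
  also have "\<dots> = sw (\<lambda>c d. sw (\<lambda>a b. S c * (S a * q * b) * d) 1) h"
    by (subst sw_swap) (simp only: S_mult mult.assoc)
  also have "\<dots> = sw (\<lambda>c d. S c * 1 * d) h" by (simp only: mult_sw[symmetric] q_cond)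
  also have "\<dots> = es h" by (simp add: antipode_es)
  finally show ?thesis by simp
qed

text \<open>
  This is the image of \<open>S(1\<^sub>1) q 1\<^sub>2 = 1\<close> under the antipode, rewritten by \<open>S(1\<^sub>2) \<otimes> S(1\<^sub>1) = 1\<^sub>1 \<otimes> 1\<^sub>2\<close>.
\<close>

lemma S_q_cond: "sw (\<lambda>a b. a * S q * S b) 1 = 1"
proof -
  have l: "Vector_Spaces.linear scale scale (\<lambda>x. S x)" by (intro lins)
  have "1 = S (sw (\<lambda>a b. S a * q * b) 1)" by (simp only: q_cond S_1)
  also have "\<dots> = sw (\<lambda>a b. S b * S q * S (S a)) 1"
    by (simp only: linear_sw[OF l] S_mult mult.assoc)
  also have "\<dots> = sw (\<lambda>a b. a * S q * S b) 1"
    by (rule sw_flip[where sW = scale]) (intro lins)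
  finally show ?thesis by simp
qed

lemma antipode_S_q: "sw (\<lambda>a b. a * S q * S b) h = et h"
proof -
  have "sw (\<lambda>a b. a * S q * S b) (h * 1) = sw (\<lambda>a b. sw (\<lambda>c d. a * c * S q * S (b * d)) 1) h"
    by (rule sw_mult[where sW = scale]) (intro lins)
  also have "\<dots> = sw (\<lambda>a b. sw (\<lambda>c d. a * (c * S q * S d) * S b) 1) h"
    by (simp only: S_mult mult.assoc)
  also have "\<dots> = sw (\<lambda>a b. a * 1 * S b) h" by (simp only: mult_sw[symmetric] S_q_cond)
  also have "\<dots> = et h" by (simp add: antipode_et)
  finally show ?thesis by simp
qed

abbreviation \<Delta>q where "\<Delta>q \<equiv> deform_comult scale q \<Delta>"
abbreviation \<epsilon>q where "\<epsilon>q \<equiv> deform_counit q \<epsilon>"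
abbreviation Sq where "Sq \<equiv> deform_antipode q S"
definition Dq where "Dq h = map (\<lambda>(a, b). (a, b * q)) (D h)"

lemma \<Delta>q: "\<Delta>q h = sw (\<lambda>a b. tensor2 scale a (b * q)) h"
  by (simp add: deform_comult_def tensor2_mult_pure)

lemma \<epsilon>q: "\<epsilon>q h = \<epsilon> (h * p)"
  by (simp add: deform_counit_def inverse_elem_eq[OF qp pq])

lemma Sq: "Sq h = p * S h * q"
  by (simp add: deform_antipode_def inverse_elem_eq[OF qp pq])

lemma sum_pairs_Dq: "sum_pairs f (Dq h) = sw (\<lambda>a b. f a (b * q)) h"
  by (simp add: sw_def Dq_def sum_pairs_def comp_def case_prod_beta)

lemma sweedler_deformed: "sweedler scale \<Delta>q Dq \<epsilon>q Sq"
proof (intro sweedler.intro sweedler_axioms.intro unital_algebra_axioms)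
  show "\<Delta>q h = sum_pairs (tensor2 scale) (Dq h)" for h by (simp add: \<Delta>q sum_pairs_Dq)
  show "Vector_Spaces.linear scale fun_scale \<Delta>q"
    unfolding \<Delta>q[abs_def] by (intro lins)
  show "Vector_Spaces.linear scale (*) \<epsilon>q" unfolding \<epsilon>q[abs_def] by (intro lins)
  show "Vector_Spaces.linear scale scale Sq" unfolding Sq[abs_def] by (intro lins)
qed

text \<open>
  A factor \<open>p = q\<^sup>-\<^sup>1\<close> next to \<open>h\<^sub>1\<close> is absorbed by \<open>h\<^sub>1 p \<otimes> h\<^sub>2 = \<Delta>(h p)\<close>, which turns the deformed axiom at \<open>h\<close>
  into an identity for the original operations at \<open>h p\<close>.
\<close>

lemma weak_hopf_deformed: "weak_hopf_algebra scale \<Delta>q \<epsilon>q Sq"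
proof -
  interpret d: sweedler scale \<Delta>q Dq \<epsilon>q Sq by (rule sweedler_deformed)
  have dsw_k: "d.sw f h = sw (\<lambda>a b. f a (b * q)) h" for f :: "'a \<Rightarrow> 'a \<Rightarrow> 'k" and h
    by (simp only: d.sw_def sum_pairs_Dq)
  have dsw_a: "d.sw f h = sw (\<lambda>a b. f a (b * q)) h" for f :: "'a \<Rightarrow> 'a \<Rightarrow> 'a" and h
    by (simp only: d.sw_def sum_pairs_Dq)
  have dsw_2: "d.sw f h = sw (\<lambda>a b. f a (b * q)) h" for f :: "'a \<Rightarrow> 'a \<Rightarrow> ('k, 'a) tensor2" and h
    by (simp only: d.sw_def sum_pairs_Dq)
  have dsw_3: "d.sw f h = sw (\<lambda>a b. f a (b * q)) h" for f :: "'a \<Rightarrow> 'a \<Rightarrow> ('k, 'a) tensor3" and h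
    by (simp only: d.sw_def sum_pairs_Dq)
  let ?T = "tensor3 scale"
  show ?thesis
    unfolding d.weak_hopf_algebra_iff dsw_k dsw_a dsw_2 dsw_3 \<epsilon>q Sq
  proof (intro conjI allI)
    fix h
    have "sw (\<lambda>a b. sw (\<lambda>x y. ?T x (y * q) (b * q)) a) h = sw (\<lambda>a b. sw (\<lambda>x y. ?T a (x * q) (y * q)) b) h"
      by (rule sw_coassoc[where sW = fun_scale]) (intro lins)
    also have "\<dots> = sw (\<lambda>a b. sw (\<lambda>x y. ?T a x (y * q)) (b * q)) h"
      by (rule sw_cong, rule sw_mult_Ht(1)[where sW = fun_scale, OF _ q_in, symmetric]) (intro lins)
    finally show "sw (\<lambda>a b. sw (\<lambda>x y. ?T x (y * q) (b * q)) a) h = sw (\<lambda>a b. sw (\<lambda>x y. ?T a x (y * q)) (b * q)) h" .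
  next
    fix h
    have "sw (\<lambda>a b. scale (\<epsilon> (a * p)) (b * q)) h = sw (\<lambda>a b. scale (\<epsilon> a) (b * q)) (h * p)"
      by (rule sw_mult_Ht(1)[where sW = scale, OF _ p_in, symmetric]) (intro lins)
    also have "\<dots> = h * p * q"
      by (rule sw_counit_left[where sW = scale]) (intro lins)
    finally show "sw (\<lambda>a b. scale (\<epsilon> (a * p)) (b * q)) h = h" by (simp only: cancel)
    show "sw (\<lambda>a b. scale (\<epsilon> (b * q * p)) a) h = h"
      by (simp only: cancel) (rule sw_counit_right, intro lins)
  next
    fix h g
    show "sw (\<lambda>a b. tensor2 scale a (b * q)) (h * g)
      = sw (\<lambda>a b. sw (\<lambda>c d. tensor2 scale (a * c) (b * q * (d * q))) g) h"
      unfolding mult.assoc[symmetric] by (rule sw_q[where sW = fun_scale, symmetric]) (intro lins)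
  next
    \<comment> \<open>The first leg of \<open>\<Delta>(1)\<close> lies in \<open>H\<^sub>s\<close> and therefore commutes with \<open>q\<close>.\<close>
    have "sw (\<lambda>a b. sw (\<lambda>x y. ?T x (y * q) (b * q)) a) 1 = sw (\<lambda>a b. sw (\<lambda>c d. ?T a (b * c * q) (d * q)) 1) 1"
      by (rule sw_one_left[where sW = fun_scale]) (intro lins)
    also have "\<dots> = sw (\<lambda>a b. sw (\<lambda>c d. ?T a (b * es c * q) (d * q)) 1) 1"
      by (rule sw_cong, rule one_es[where sW = fun_scale, symmetric]) (intro lins)
    also have "\<dots> = sw (\<lambda>a b. sw (\<lambda>c d. ?T a (b * q * es c) (d * q)) 1) 1"
      by (simp only: mult.assoc Ht_Hs_commute[OF q_in es_in])
    also have "\<dots> = sw (\<lambda>a b. sw (\<lambda>c d. ?T a (b * q * c) (d * q)) 1) 1"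
      by (rule sw_cong, rule one_es[where sW = fun_scale]) (intro lins)
    finally show "sw (\<lambda>a b. sw (\<lambda>x y. ?T x (y * q) (b * q)) a) 1 = sw (\<lambda>a b. sw (\<lambda>c d. ?T a (b * q * c) (d * q)) 1) 1" .
    have "sw (\<lambda>a b. sw (\<lambda>x y. ?T x (y * q) (b * q)) a) 1 = sw (\<lambda>c d. sw (\<lambda>a b. ?T a (c * b * q) (d * q)) 1) 1"
      by (rule sw_one_right[where sW = fun_scale]) (intro lins)
    then show "sw (\<lambda>a b. sw (\<lambda>x y. ?T x (y * q) (b * q)) a) 1 = sw (\<lambda>c d. sw (\<lambda>a b. ?T a (c * (b * q)) (d * q)) 1) 1"
      by (simp only: mult.assoc)
  next
    fix f g h
    have "sw (\<lambda>a b. \<epsilon> (f * a * p) * \<epsilon> (b * q * h * p)) g = sw (\<lambda>a b. \<epsilon> (f * (a * p)) * \<epsilon> (b * (q * h * p))) g"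
      by (simp only: mult.assoc)
    also have "\<dots> = sw (\<lambda>a b. \<epsilon> (f * a) * \<epsilon> (b * (q * h * p))) (g * p)"
      by (rule sw_mult_Ht(1)[where sW = "(*)", OF _ p_in, symmetric]) (intro lins)
    also have "\<dots> = \<epsilon> (f * (g * p) * (q * h * p))" by (rule counit_12[symmetric])
    finally show "\<epsilon> (f * g * h * p) = sw (\<lambda>a b. \<epsilon> (f * a * p) * \<epsilon> (b * q * h * p)) g"
      by (simp only: mult.assoc cancel)
    show "\<epsilon> (f * g * h * p) = sw (\<lambda>a b. \<epsilon> (f * (b * q) * p) * \<epsilon> (a * h * p)) g"
      using counit_21[of f g "h * p"] by (simp only: mult.assoc qp mult_1_right)
  next
    fix h
    have "sw (\<lambda>a b. a * (p * S (b * q) * q)) h = sw (\<lambda>a b. a * p * S q * S b) h * q"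
      by (simp only: mult_sw S_mult mult.assoc)
    also have "sw (\<lambda>a b. a * p * S q * S b) h = sw (\<lambda>a b. a * S q * S b) (h * p)"
      by (rule sw_mult_Ht(1)[where sW = scale, OF _ p_in, symmetric]) (intro lins)
    also have "\<dots> = sw (\<lambda>a b. scale (\<epsilon> (a * (h * p))) b) 1"
      by (simp only: antipode_S_q et_sw)
    finally show "sw (\<lambda>a b. a * (p * S (b * q) * q)) h = sw (\<lambda>a b. scale (\<epsilon> (a * h * p)) (b * q)) 1"
      by (simp only: mult_sw mult.assoc scale_mult_left)
    have "sw (\<lambda>a b. p * S a * q * (b * q)) h = p * (sw (\<lambda>a b. S a * q * b) h) * q"
      by (simp only: mult_sw mult.assoc)
    also have "\<dots> = p * (es h * q)" by (simp only: antipode_q) (simp only: mult.assoc)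
    also have "\<dots> = es h" by (simp only: Ht_Hs_commute[OF q_in es_in, symmetric] cancel)
    finally show "sw (\<lambda>a b. p * S a * q * (b * q)) h = sw (\<lambda>a b. scale (\<epsilon> (h * (b * q) * p)) a) 1"
      by (simp only: es_sw mult.assoc qp mult_1_right)
  next
    fix h
    have "sw (\<lambda>a b. sw (\<lambda>x y. p * S x * q * (y * q) * (p * S (b * q) * q)) a) h
      = p * sw (\<lambda>a b. sw (\<lambda>x y. S x * q * y) a * S q * S b) h * q"
      by (simp only: mult_sw S_mult mult.assoc cancel)
    also have "sw (\<lambda>a b. sw (\<lambda>x y. S x * q * y) a * S q * S b) h
      = sw (\<lambda>a b. sw (\<lambda>x y. S x * y * S q * S b) a) h"
      by (simp only: antipode_q antipode_es[symmetric] mult_sw)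
    also have "\<dots> = sw (\<lambda>a b. sw (\<lambda>x y. S a * x * S q * S y) b) h"
      by (rule sw_coassoc[where sW = scale]) (intro lins)
    also have "\<dots> = sw (\<lambda>a b. S a * sw (\<lambda>x y. x * S q * S y) b) h"
      by (simp only: mult_sw mult.assoc)
    also have "\<dots> = S h" by (simp only: antipode_S_q S_et)
    finally show "p * S h * q = sw (\<lambda>a b. sw (\<lambda>x y. p * S x * q * (y * q) * (p * S (b * q) * q)) a) h"
      by simp
  qed
qed

lemma et_deformed: "counital_t scale \<Delta>q \<epsilon>q h = et (h * p) * q"
proof -
  interpret d: sweedler scale \<Delta>q Dq \<epsilon>q Sq by (rule sweedler_deformed)
  have "counital_t scale \<Delta>q \<epsilon>q h = d.sw (\<lambda>a b. scale (\<epsilon>q (a * h)) b) 1"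
    unfolding counital_t_def by (rule d.lift2_comult, intro d.lin)
  then show ?thesis unfolding et_sw mult_sw
    by (simp only: d.sw_def sum_pairs_Dq \<epsilon>q mult.assoc scale_mult_left)
qed

lemma es_deformed: "counital_s scale \<Delta>q \<epsilon>q h = es h"
proof -
  interpret d: sweedler scale \<Delta>q Dq \<epsilon>q Sq by (rule sweedler_deformed)
  have "counital_s scale \<Delta>q \<epsilon>q h = d.sw (\<lambda>a b. scale (\<epsilon>q (h * b)) a) 1"
    unfolding counital_s_def by (rule d.lift2_comult, intro d.lin)
  then show ?thesis unfolding es_sw
    by (simp only: d.sw_def sum_pairs_Dq \<epsilon>q mult.assoc qp mult_1_right)
qed

lemma Ht_deformed: "target_base scale \<Delta>q \<epsilon>q = Ht"
proof -
  have "et (h * p) * q \<in> Ht" for h by (intro Ht_mult et_in q_in)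
  moreover have "z = et (z * q * p * p) * q" if "z \<in> Ht" for z
  proof -
    have "et (z * p) = z * p" using Ht_mult[OF that p_in] by (simp add: Ht_iff)
    then show ?thesis by (simp add: cancel)
  qed
  ultimately show ?thesis
    unfolding target_base_def[of scale \<Delta>q] et_deformed by (auto intro!: range_eqI[of _ _ "z * q * p" for z])
qed

lemma Hs_deformed: "source_base scale \<Delta>q \<epsilon>q = Hs"
  unfolding source_base_def es_deformed ..

lemma undeform:
  "deform_comult scale p \<Delta>q = \<Delta>" "deform_counit p \<epsilon>q = \<epsilon>" "deform_antipode p Sq = S"
proof -
  interpret d: sweedler scale \<Delta>q Dq \<epsilon>q Sq by (rule sweedler_deformed)
  have "d.sw (\<lambda>a b. tensor2 scale a (b * p)) h = \<Delta> h" for h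
    by (simp only: d.sw_def sum_pairs_Dq cancel comult_eq[of h] sw_def)
  then show "deform_comult scale p \<Delta>q = \<Delta>"
    by (intro ext[of "deform_comult scale p \<Delta>q"])
      (simp only: deform_comult_def[of _ p] d.tensor2_mult_pure mult_1_right)
  show "deform_counit p \<epsilon>q = \<epsilon>"
    by (intro ext, unfold deform_counit_def[of p] inverse_elem_eq[OF pq qp] \<epsilon>q) (simp only: cancel)
  show "deform_antipode p Sq = S"
    by (intro ext, unfold deform_antipode_def[of p] inverse_elem_eq[OF pq qp] Sq)
      (simp only: mult.assoc cancel qp mult_1_right)
qed

lemma deformation_elem_undeform:
  assumes "Sq (Sq p) = p"
  shows "deformation_elem scale \<Delta>q \<epsilon>q Sq p"
  unfolding deformation_elem_def Ht_deformed
proof (intro conjI p_in assms)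
  interpret d: sweedler scale \<Delta>q Dq \<epsilon>q Sq by (rule sweedler_deformed)
  show "invertible_elem p" unfolding invertible_elem_def using pq qp by blast
  have "lift2 scale scale (\<lambda>a b. Sq a * p * b) (\<Delta>q 1) = d.sw (\<lambda>a b. Sq a * p * b) 1"
    by (rule d.lift2_comult, intro d.lin)
  also have "\<dots> = p * sw (\<lambda>a b. S a * b) 1 * q"
    by (simp only: d.sw_def sum_pairs_Dq Sq mult_sw mult.assoc cancel)
  also have "\<dots> = 1" by (simp add: antipode_es pq)
  finally show "lift2 scale scale (\<lambda>a b. Sq a * p * b) (\<Delta>q 1) = 1" .
qed

end
section \<open>The trace of the regular representation\<close>

text \<open>
  The trace of \<open>t \<mapsto> \<Sum>i. \<phi>\<^sub>i(t) w\<^sub>i\<close> can be read off from any such expansion, where the \<open>w\<^sub>i\<close> need not form a basis.  This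
  makes the basis chosen in the definition of the trace irrelevant and applies both to dual bases given by \<open>\<Delta>(1)\<close> and
  to a basis of the image of an idempotent.
\<close>

lemma (in vector_space) trace_on_expansion:
  assumes V: "subspace V" "finite F" "V \<subseteq> span F" and I: "finite I"
    and \<phi>: "\<And>i. i \<in> I \<Longrightarrow> Vector_Spaces.linear scale (*) (\<phi> i)"
    and w: "\<And>i. i \<in> I \<Longrightarrow> w i \<in> V"
    and f: "\<And>t. t \<in> V \<Longrightarrow> f t = (\<Sum>i\<in>I. scale (\<phi> i t) (w i))"
  shows "trace_on scale V f = (\<Sum>i\<in>I. \<phi> i (w i))"
proof -
  define B where "B = (SOME B. independent B \<and> span B = V)"
  obtain B0 where "B0 \<subseteq> V" "independent B0" "V \<subseteq> span B0"
    using maximal_independent_subset .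
  then have "\<exists>B. independent B \<and> span B = V"
    using span_minimal[OF _ V(1), of B0] by blast
  then have "independent B \<and> span B = V" unfolding B_def by (rule someI_ex)
  then have B: "independent B" "span B = V" by auto
  have BV: "B \<subseteq> V" using span_superset[of B] B(2) by simp
  have fin: "finite B" using independent_span_bound[OF V(2) B(1)] BV V(3) by auto
  have ws: "w i \<in> span B" if "i \<in> I" for i using w[OF that] B(2) by simp
  have "trace_on scale V f = (\<Sum>b\<in>B. representation B (f b) b)"
    unfolding trace_on_def B_def Let_def ..
  also have "\<dots> = (\<Sum>b\<in>B. \<Sum>i\<in>I. \<phi> i b * representation B (w i) b)"
  proof (rule sum.cong[OF refl])
    fix b assume "b \<in> B"
    then have "f b = (\<Sum>i\<in>I. scale (\<phi> i b) (w i))" using f BV by blast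
    then show "representation B (f b) b = (\<Sum>i\<in>I. \<phi> i b * representation B (w i) b)"
      by (simp add: representation_sum[OF B(1)] span_scale ws representation_scale[OF B(1)])
  qed
  also have "\<dots> = (\<Sum>i\<in>I. \<Sum>b\<in>B. \<phi> i b * representation B (w i) b)" by (rule sum.swap)
  also have "\<dots> = (\<Sum>i\<in>I. \<phi> i (w i))"
  proof (rule sum.cong[OF refl])
    fix i assume i: "i \<in> I"
    interpret \<phi>: Vector_Spaces.linear scale "(*)" "\<phi> i" by (rule \<phi>[OF i])
    have "\<phi> i (\<Sum>b\<in>B. scale (representation B (w i) b) b) = (\<Sum>b\<in>B. representation B (w i) b * \<phi> i b)"
      by (simp add: \<phi>.sum \<phi>.scale)
    then show "(\<Sum>b\<in>B. \<phi> i b * representation B (w i) b) = \<phi> i (w i)"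
      using sum_representation_eq[OF B(1) ws[OF i] fin subset_refl] by (simp add: mult.commute)
  qed
  finally show ?thesis .
qed

lemma sum_pairs_nth: "sum_pairs f xs = (\<Sum>i<length xs. f (fst (xs ! i)) (snd (xs ! i)))"
  by (simp add: sum_pairs_def sum_list_sum_nth atLeast0LessThan)

context sweedler_wha
begin

lemma Ht_subspace: "subspace Ht"
proof -
  interpret l: Vector_Spaces.linear scale scale et by (intro lins)
  show ?thesis by (auto simp: subspace_def Ht_iff l.add l.scale l.zero)
qed

lemma Ht_finite: "\<exists>F. finite F \<and> Ht \<subseteq> span F"
proof (intro exI conjI subsetI)
  show "finite (snd ` set (D 1))" by simp
  fix z assume "z \<in> Ht"
  then have z: "z = et z" by (simp add: Ht_iff)
  have "sum_pairs (\<lambda>a b. scale (\<epsilon> (a * z)) b) xs \<in> span (snd ` set xs)" for xs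
  proof -
    have "(\<Sum>i<length xs. scale (\<epsilon> (fst (xs ! i) * z)) (snd (xs ! i))) \<in> span (snd ` set xs)"
      by (intro span_sum span_scale span_base) auto
    then show ?thesis by (simp add: sum_pairs_nth)
  qed
  then show "z \<in> span (snd ` set (D 1))"
    by (subst z, unfold et_sw sw_def)
qed

abbreviation Tr where "Tr \<equiv> regular_trace scale Ht"

text \<open>
  The Casimir element of \<open>H\<^sub>t\<close> for the form \<open>\<epsilon>(a b)\<close>: the product \<open>1\<^sub>2 S(1\<^sub>1)\<close> of the dual bases.
\<close>

definition casimir where "casimir = sw (\<lambda>a b. b * S a) 1"

text \<open>
  From \<open>b t = \<epsilon>(1\<^sub>1 b t) 1\<^sub>2\<close> the operator \<open>t \<mapsto> a b t\<close> has the expansion \<open>\<epsilon>(1\<^sub>1 b t) a 1\<^sub>2\<close>.  Splitting the element as \<open>a b\<close> gives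
  the symmetry of the trace at once, the right side being invariant under \<open>(a, b) \<mapsto> (b a, 1)\<close>.
\<close>

lemma Tr_sw:
  assumes a: "a \<in> Ht" and b: "b \<in> Ht"
  shows "Tr (a * b) = sw (\<lambda>x y. \<epsilon> (x * (b * a * y))) 1"
proof -
  obtain F where F: "finite F" "Ht \<subseteq> span F" using Ht_finite by blast
  let ?x = "\<lambda>i. fst (D 1 ! i)" and ?y = "\<lambda>i. snd (D 1 ! i)"
  have "Tr (a * b) = (\<Sum>i<length (D 1). \<epsilon> (?x i * (b * (a * et (?y i)))))"
    unfolding regular_trace_def
  proof (rule trace_on_expansion[OF Ht_subspace F, where \<phi> = "\<lambda>i t. \<epsilon> (?x i * (b * t))"
        and w = "\<lambda>i. a * et (?y i)"])
    show "Vector_Spaces.linear scale (*) (\<lambda>t. \<epsilon> (?x i * (b * t)))" for i by (intro lins)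
    show "a * et (?y i) \<in> Ht" for i by (intro Ht_mult a et_in)
    fix t assume t: "t \<in> Ht"
    have "et (b * t) = b * t" using Ht_mult[OF b t] by (simp add: Ht_iff)
    then have "a * b * t = a * et (et (b * t))" by (simp add: mult.assoc)
    also have "\<dots> = a * et (sw (\<lambda>x y. scale (\<epsilon> (x * (b * t))) y) 1)" by (simp only: et_sw[of "b * t"])
    also have "\<dots> = sw (\<lambda>x y. scale (\<epsilon> (x * (b * t))) (a * et y)) 1"
    proof -
      have l: "Vector_Spaces.linear scale scale (\<lambda>u. a * et u)" by (intro lins)
      interpret l: Vector_Spaces.linear scale scale "\<lambda>u. a * et u" by (rule l)
      show ?thesis by (simp only: linear_sw[OF l] l.scale)
    qed
    finally show "a * b * t = (\<Sum>i<length (D 1). scale (\<epsilon> (?x i * (b * t))) (a * et (?y i)))"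
      by (simp only: sw_def sum_pairs_nth)
  qed simp
  also have "\<dots> = sw (\<lambda>x y. \<epsilon> (x * (b * (a * et y)))) 1" by (simp only: sw_def sum_pairs_nth)
  also have "\<dots> = sw (\<lambda>x y. \<epsilon> (x * (b * (a * y)))) 1"
    by (rule one_et[where sW = "(*)"]) (intro lins)
  finally show ?thesis by (simp only: mult.assoc)
qed

lemma Tr_commute:
  assumes a: "a \<in> Ht" and b: "b \<in> Ht"
  shows "Tr (a * b) = Tr (b * a)"
  using Tr_sw[OF a b] Tr_sw[OF Ht_mult[OF b a] one_in_bases(1)] by simp

lemma Tr_eq:
  assumes b: "b \<in> Ht"
  shows "Tr b = \<epsilon> (b * casimir)"
proof -
  have l: "Vector_Spaces.linear scale (*) (\<lambda>x. \<epsilon> (b * x))" by (intro lins)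
  have "Tr b = sw (\<lambda>x y. \<epsilon> (x * (b * y))) 1"
    using Tr_sw[OF b one_in_bases(1)] by simp
  also have "\<dots> = sw (\<lambda>x y. \<epsilon> (x * (b * et y))) 1"
    by (rule one_et[where sW = "(*)", symmetric]) (intro lins)
  also have "\<dots> = sw (\<lambda>x y. \<epsilon> (es x * (b * et y))) 1"
    by (rule one_es[where sW = "(*)", symmetric]) (intro lins)
  also have "\<dots> = sw (\<lambda>x y. \<epsilon> (b * et y * et (es x))) 1"
    by (simp only: Ht_Hs_commute[OF Ht_mult[OF b et_in] es_in, symmetric] counit_mult_et)
  also have "\<dots> = sw (\<lambda>x y. \<epsilon> (b * et y * S (es x))) 1"
    by (simp only: S_Hs[OF es_in])
  also have "\<dots> = sw (\<lambda>x y. \<epsilon> (b * et y * S x)) 1"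
    by (rule one_es[where sW = "(*)"]) (intro lins)
  also have "\<dots> = sw (\<lambda>x y. \<epsilon> (b * y * S x)) 1"
    by (rule one_et[where sW = "(*)"]) (intro lins)
  also have "\<dots> = \<epsilon> (b * casimir)"
    unfolding casimir_def by (simp only: linear_sw[OF l] mult.assoc)
  finally show ?thesis .
qed

text \<open>
  The trace of left multiplication by \<open>f\<close> is the dimension of \<open>f H\<^sub>t\<close>, a natural number.
\<close>

lemma idempotent_trace_zero:
  assumes char: "CHAR('k) = 0" and f: "f \<in> Ht" "f * f = f" and Tr: "Tr f = 0"
  shows "f = 0"
proof -
  obtain F where F: "finite F" "Ht \<subseteq> span F" using Ht_finite by blast
  define W where "W = (*) f ` Ht"
  have WH: "W \<subseteq> Ht" unfolding W_def using Ht_mult[OF f(1)] by blast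
  obtain C where C: "C \<subseteq> W" "independent C" "W \<subseteq> span C"
    using maximal_independent_subset .
  have fin: "finite C" using independent_span_bound[OF F(1) C(2)] C(1) WH F(2) by blast
  define E where "E = extend_basis C"
  have E: "independent E" "span E = UNIV" "C \<subseteq> E"
    unfolding E_def using independent_extend_basis[OF C(2)] span_extend_basis[OF C(2)]
      extend_basis_superset[OF C(2)] by auto
  have fc: "f * x = x" if "x \<in> C" for x
    using that C(1) f(2) unfolding W_def by (auto simp: mult.assoc[symmetric])
  have "Tr f = (\<Sum>x\<in>C. representation E (f * x) x)"
    unfolding regular_trace_def
  proof (rule trace_on_expansion[OF Ht_subspace F fin, where \<phi> = "\<lambda>x t. representation E (f * t) x"
        and w = "\<lambda>x. x"])
    show "Vector_Spaces.linear scale (*) (\<lambda>t. representation E (f * t) x)" for x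
      by (rule linear_comp[OF _ linear_representation[OF E(1,2)]]) (intro lins)
    show "x \<in> C \<Longrightarrow> x \<in> Ht" for x using C(1) WH by blast
    fix t assume "t \<in> Ht"
    then have "f * t \<in> span C" using C(3) unfolding W_def by blast
    then show "f * t = (\<Sum>x\<in>C. scale (representation E (f * t) x) x)"
      using sum_representation_eq[OF C(2) _ fin subset_refl, of "f * t"]
        representation_extend[OF E(1) _ E(3), of "f * t"] by simp
  qed
  also have "\<dots> = (\<Sum>x\<in>C. 1)"
    using E(3) by (intro sum.cong) (auto simp: fc representation_basis[OF E(1)])
  also have "\<dots> = of_nat (card C)" by simp
  finally have "of_nat (card C) = (0 :: 'k)" using Tr by simp
  then have "card C = 0" using char by (simp add: of_nat_eq_0_iff_char_dvd)
  then have "C = {}" using fin by simp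
  then have "W \<subseteq> {0}" using C(3) by simp
  moreover have "f * 1 \<in> W" unfolding W_def using one_in_bases(1) by (rule imageI)
  ultimately show ?thesis by auto
qed

lemma sw_in_subspace:
  assumes "subspace V" "\<And>a b. f a b \<in> V"
  shows "sw f h \<in> V"
proof -
  have "sum_pairs f xs \<in> V" for xs
    by (induction xs) (auto intro: subspace_0 subspace_add assms)
  then show ?thesis by (simp add: sw_def)
qed

lemma scale_sw: "scale r (sw f h) = sw (\<lambda>a b. scale r (f a b)) h"
  by (rule linear_sw[of scale scale]) (rule linear_scale_self)

text \<open>
  A preimage is \<open>1\<^sub>1 \<epsilon>(1\<^sub>2 z)\<close>; outer \<open>es\<close> and \<open>et\<close> around such witnesses only make their membership in the base evident.
\<close>

lemma S_Hs_surj: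
  assumes z: "z \<in> Ht"
  shows "\<exists>y\<in>Hs. S y = z"
proof
  let ?y = "es (sw (\<lambda>a b. scale (\<epsilon> (b * z)) a) 1)"
  show "?y \<in> Hs" by (rule es_in)
  have l: "Vector_Spaces.linear scale scale (\<lambda>x. et (es x))" by (intro lins)
  interpret l: Vector_Spaces.linear scale scale "\<lambda>x. et (es x)" by (rule l)
  have "S ?y = sw (\<lambda>a b. scale (\<epsilon> (b * z)) (et (es a))) 1"
    by (simp only: S_Hs[OF es_in] linear_sw[OF l] l.scale)
  also have "\<dots> = sw (\<lambda>a b. scale (\<epsilon> (b * z)) (et a)) 1"
    by (rule one_es[where sW = scale]) (intro lins)
  also have "\<dots> = sw (\<lambda>a b. sw (\<lambda>e d. scale (\<epsilon> (e * a) * \<epsilon> (b * z)) d) 1) 1"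
    by (simp only: et_sw scale_sw scale_scale mult.commute)
  also have "\<dots> = sw (\<lambda>e d. sw (\<lambda>a b. scale (\<epsilon> (e * a) * \<epsilon> (b * z)) d) 1) 1" by (rule sw_swap)
  also have "\<dots> = sw (\<lambda>e d. scale (\<epsilon> (e * z)) d) 1"
  proof (rule sw_cong)
    fix e d
    have l: "Vector_Spaces.linear (*) scale (\<lambda>r. scale r d)"
      by (rule linear_I[OF vector_space_mult vector_space_axioms]) (simp_all add: scale_left_distrib)
    show "sw (\<lambda>a b. scale (\<epsilon> (e * a) * \<epsilon> (b * z)) d) 1 = scale (\<epsilon> (e * z)) d"
      using linear_sw[OF l] counit_12[of e 1 z] by simp
  qed
  also have "\<dots> = z" using z by (simp only: et_sw[symmetric] Ht_iff)
  finally show "S ?y = z" .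
qed

lemma S_Ht_surj:
  assumes y: "y \<in> Hs"
  shows "\<exists>z\<in>Ht. S z = y"
proof
  let ?z = "et (sw (\<lambda>a b. scale (\<epsilon> (y * a)) b) 1)"
  show "?z \<in> Ht" by (rule et_in)
  have l: "Vector_Spaces.linear scale scale (\<lambda>x. es (et x))" by (intro lins)
  interpret l: Vector_Spaces.linear scale scale "\<lambda>x. es (et x)" by (rule l)
  have "S ?z = sw (\<lambda>a b. scale (\<epsilon> (y * a)) (es (et b))) 1"
    by (simp only: S_Ht[OF et_in] linear_sw[OF l] l.scale)
  also have "\<dots> = sw (\<lambda>a b. scale (\<epsilon> (y * a)) (es b)) 1"
    by (rule one_et[where sW = scale]) (intro lins)
  also have "\<dots> = sw (\<lambda>a b. sw (\<lambda>e d. scale (\<epsilon> (y * a) * \<epsilon> (b * d)) e) 1) 1"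
    by (simp only: es_sw scale_sw scale_scale)
  also have "\<dots> = sw (\<lambda>e d. sw (\<lambda>a b. scale (\<epsilon> (y * a) * \<epsilon> (b * d)) e) 1) 1" by (rule sw_swap)
  also have "\<dots> = sw (\<lambda>e d. scale (\<epsilon> (y * d)) e) 1"
  proof (rule sw_cong)
    fix e d
    have l: "Vector_Spaces.linear (*) scale (\<lambda>r. scale r e)"
      by (rule linear_I[OF vector_space_mult vector_space_axioms]) (simp_all add: scale_left_distrib)
    show "sw (\<lambda>a b. scale (\<epsilon> (y * a) * \<epsilon> (b * d)) e) 1 = scale (\<epsilon> (y * d)) e"
      using linear_sw[OF l] counit_12[of y 1 d] by simp
  qed
  also have "\<dots> = y" using y by (simp only: es_sw[symmetric] Hs_iff)
  finally show "S ?z = y" .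
qed

text \<open>
  Maschke's argument: for a linear projection \<open>\<pi>\<close> onto \<open>L\<close>, the map \<open>x \<mapsto> S(1\<^sub>1) \<pi>(1\<^sub>2 x)\<close> is a projection onto \<open>L\<close> which is linear over \<open>H\<^sub>t\<close>,
  hence right multiplication by its value \<open>f\<close> at 1.
\<close>

lemma left_ideal_idempotent:
  assumes L: "subspace L" "L \<subseteq> Ht" "\<And>a n. a \<in> Ht \<Longrightarrow> n \<in> L \<Longrightarrow> a * n \<in> L"
  shows "\<exists>f\<in>L. \<forall>n\<in>L. n * f = n"
proof -
  interpret vp: vector_space_pair scale scale by unfold_locales
  obtain \<pi> where \<pi>: "\<And>x. \<pi> x \<in> L" "Vector_Spaces.linear scale scale \<pi>" "\<And>n. n \<in> L \<Longrightarrow> \<pi> n = n"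
    using vp.linear_exists_left_inverse_on[OF linear_id' L(1)] by (auto simp: image_subset_iff)
  note \<pi>_lin = linear_comp[OF _ \<pi>(2)]
  define f where "f = sw (\<lambda>a b. S a * \<pi> b) 1"
  have "f = sw (\<lambda>a b. S (es a) * \<pi> b) 1"
    unfolding f_def by (rule one_es[where sW = scale, symmetric]) (intro lins \<pi>_lin)
  then have "f \<in> L" by (simp add: sw_in_subspace[OF L(1)] L(3) S_Hs_in \<pi>(1))
  moreover have "n * f = n" if n: "n \<in> L" for n
  proof -
    obtain y where y: "y \<in> Hs" "S y = n" using S_Hs_surj n L(2) by blast
    have "n * f = sw (\<lambda>a b. S (a * y) * \<pi> b) 1"
      unfolding f_def by (simp only: y(2)[symmetric] S_mult mult_sw mult.assoc)
    also have "\<dots> = sw (\<lambda>a b. S a * \<pi> (b * n)) 1"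
      unfolding y(2)[symmetric]
      by (rule sw_one_Hs[where sW = scale, OF _ y(1)]) (intro lins \<pi>_lin)
    also have "\<dots> = sw (\<lambda>a b. S a * \<pi> (et b * n)) 1"
      by (rule one_et[where sW = scale, symmetric]) (intro lins \<pi>_lin)
    also have "\<dots> = sw (\<lambda>a b. S a * (et b * n)) 1" by (simp only: \<pi>(3)[OF L(3)[OF et_in n]])
    also have "\<dots> = sw (\<lambda>a b. S a * (b * n)) 1"
      by (rule one_et[where sW = scale]) (intro lins \<pi>_lin)
    also have "\<dots> = sw (\<lambda>a b. S a * b) 1 * n" by (simp only: mult_sw mult.assoc)
    also have "\<dots> = n" by (simp add: antipode_es)
    finally show ?thesis .
  qed
  ultimately show ?thesis by blast
qed

text \<open>
  \<open>S\<^sup>2\<close> is the Nakayama automorphism of the restriction of \<open>\<epsilon>\<close> to \<open>H\<^sub>t\<close>.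
\<close>

lemma counit_S_S:
  assumes z: "z \<in> Ht" and t: "t \<in> Ht"
  shows "\<epsilon> (z * t) = \<epsilon> (t * S (S z))"
proof -
  have "\<epsilon> (z * t) = \<epsilon> (es z * t)" by (simp only: counit_es_mult)
  also have "\<dots> = \<epsilon> (t * et (es z))" by (simp only: Ht_Hs_commute[OF t es_in, symmetric] counit_mult_et)
  also have "\<dots> = \<epsilon> (t * S (S z))" by (simp only: S_Ht[OF z] S_Hs[OF es_in])
  finally show ?thesis .
qed

text \<open>
  The legs \<open>1\<^sub>1\<close> in \<open>w = \<epsilon>(1\<^sub>1 w) 1\<^sub>2\<close> are of the form \<open>S(z)\<close> with \<open>z\<close> in \<open>H\<^sub>t\<close>, and \<open>\<epsilon>(S(z) w) = \<epsilon>(z w)\<close>.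
\<close>

lemma counit_nondegenerate:
  assumes w: "w \<in> Ht" and 0: "\<And>a. a \<in> Ht \<Longrightarrow> \<epsilon> (a * w) = 0"
  shows "w = 0"
proof -
  have "\<epsilon> (es x * w) = 0" for x
  proof -
    obtain z where z: "z \<in> Ht" "S z = es x" using S_Ht_surj[OF es_in] by blast
    then have "\<epsilon> (es x * w) = \<epsilon> (es z * w)" by (simp add: S_Ht)
    then show ?thesis using 0[OF z(1)] by (simp add: counit_es_mult)
  qed
  moreover have "w = et w" using w by (simp add: Ht_iff)
  moreover have "et w = sw (\<lambda>a b. scale (\<epsilon> (es a * w)) b) 1"
    unfolding et_sw by (rule one_es[where sW = scale, symmetric]) (intro lins)
  ultimately have "w = sw (\<lambda>a b. 0) 1" by simp
  then show ?thesis by (simp add: sw_def sum_pairs_zero)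
qed

lemma casimir_in: "casimir \<in> Ht"
proof -
  have "casimir = sw (\<lambda>a b. b * S (es a)) 1"
    unfolding casimir_def by (rule one_es[where sW = scale, symmetric]) (intro lins)
  also have "\<dots> = sw (\<lambda>a b. et b * S (es a)) 1"
    by (rule one_et[where sW = scale, symmetric]) (intro lins)
  finally show ?thesis
    by (simp add: sw_in_subspace[OF Ht_subspace] Ht_mult S_Hs_in)
qed

text \<open>
  The trace \<open>\<epsilon>(_ c)\<close> is symmetric while \<open>\<epsilon>\<close> is symmetric only up to \<open>S\<^sup>2\<close>; nondegeneracy of \<open>\<epsilon>\<close> turns the comparison into a relation for \<open>c\<close>.
\<close>

lemma casimir_commute:
  assumes b: "b \<in> Ht"
  shows "b * casimir = casimir * S (S b)"
proof -
  have S: "S (S b) \<in> Ht" by (intro S_Hs_in S_Ht_in b)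
  have "b * casimir - casimir * S (S b) = 0"
  proof (rule counit_nondegenerate)
    show "b * casimir - casimir * S (S b) \<in> Ht" by (intro subspace_diff[OF Ht_subspace] Ht_mult b casimir_in S)
    fix a assume a: "a \<in> Ht"
    interpret e: Vector_Spaces.linear scale "(*)" \<epsilon> by (rule counit_lin)
    have "\<epsilon> (a * (b * casimir)) = Tr (a * b)" using Tr_eq[OF Ht_mult[OF a b]] by (simp add: mult.assoc)
    also have "\<dots> = Tr (b * a)" by (rule Tr_commute[OF a b])
    also have "\<dots> = \<epsilon> (b * (a * casimir))" using Tr_eq[OF Ht_mult[OF b a]] by (simp add: mult.assoc)
    also have "\<dots> = \<epsilon> (a * (casimir * S (S b)))"
      using counit_S_S[OF b Ht_mult[OF a casimir_in]] by (simp add: mult.assoc)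
    finally show "\<epsilon> (a * (b * casimir - casimir * S (S b))) = 0" by (simp add: right_diff_distrib e.diff)
  qed
  then show ?thesis by simp
qed

text \<open>
  The radical of the trace form is an ideal, so it contains an idempotent \<open>f\<close> acting as a right unit on it; \<open>f\<close> has
  trace 0 and therefore vanishes.
\<close>

lemma trace_form_nondegenerate:
  assumes char: "CHAR('k) = 0" and x: "x \<in> Ht" and 0: "\<And>b. b \<in> Ht \<Longrightarrow> Tr (x * b) = 0"
  shows "x = 0"
proof -
  define N where "N = {x \<in> Ht. \<forall>b\<in>Ht. \<epsilon> (x * b * casimir) = 0}"
  have N: "n \<in> Ht \<and> (\<forall>b\<in>Ht. Tr (n * b) = 0)" if "n \<in> N" for n
    using that Tr_eq[OF Ht_mult] unfolding N_def by auto
  interpret e: Vector_Spaces.linear scale "(*)" \<epsilon> by (rule counit_lin)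
  have "subspace N"
    using Ht_subspace unfolding N_def subspace_def
    by (auto simp: e.add e.scale e.zero distrib_right scale_mult_left)
  moreover have "a * n \<in> N" if a: "a \<in> Ht" and n: "n \<in> N" for a n
  proof -
    have "\<epsilon> (a * n * b * casimir) = 0" if b: "b \<in> Ht" for b
    proof -
      note nH = N[OF n, THEN conjunct1]
      have "\<epsilon> (a * n * b * casimir) = Tr (a * (n * b))"
        using Tr_eq[OF Ht_mult[OF a Ht_mult[OF nH b]]] by (simp add: mult.assoc)
      also have "\<dots> = Tr (n * (b * a))"
        using Tr_commute[OF a Ht_mult[OF nH b]] by (simp add: mult.assoc)
      finally show ?thesis using N[OF n] Ht_mult[OF b a] by simp
    qed
    then show ?thesis using N[OF n] Ht_mult[OF a] unfolding N_def by blast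
  qed
  moreover have "N \<subseteq> Ht" unfolding N_def by blast
  ultimately obtain f where f: "f \<in> N" "\<And>n. n \<in> N \<Longrightarrow> n * f = n"
    using left_ideal_idempotent[of N] by blast
  have "Tr (f * 1) = 0" using N[OF f(1)] one_in_bases(1) by blast
  then have "f = 0" using idempotent_trace_zero[OF char] N[OF f(1)] f(2)[OF f(1)] by simp
  moreover have "x \<in> N" using x 0 Tr_eq[OF Ht_mult[OF x]] unfolding N_def by auto
  ultimately show ?thesis using f(2)[of x] by simp
qed

lemma mult_casimir_cancel:
  assumes char: "CHAR('k) = 0" and x: "x \<in> Ht" and xc: "x * casimir = 0"
  shows "x = 0"
proof (rule trace_form_nondegenerate[OF char x])
  fix b assume b: "b \<in> Ht"
  have "Tr (x * b) = Tr (b * x)" by (rule Tr_commute[OF x b])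
  also have "\<dots> = \<epsilon> (b * (x * casimir))" using Tr_eq[OF Ht_mult[OF b x]] by (simp add: mult.assoc)
  also have "\<dots> = 0" using xc Vector_Spaces.linear.axioms(3)[OF counit_lin]
    by (simp add: module_hom.zero[OF counit_lin[unfolded linear_iff_module_hom]])
  finally show "Tr (x * b) = 0" .
qed

text \<open>
  The left ideal \<open>H\<^sub>t c\<close> has a right unit \<open>f\<close>, so \<open>c (f - 1) = 0\<close>.  As \<open>f - 1 = S\<^sup>2(b)\<close> for some \<open>b\<close>, this says \<open>b c = 0\<close>, whence
  \<open>b = 0\<close> and \<open>f = 1\<close>.
\<close>

lemma casimir_invertible:
  assumes char: "CHAR('k) = 0"
  shows "\<exists>d\<in>Ht. casimir * d = 1 \<and> d * casimir = 1"
proof -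
  define L where "L = (\<lambda>a. a * casimir) ` Ht"
  interpret l: Vector_Spaces.linear scale scale "\<lambda>a. a * casimir" by (intro lins)
  have "subspace L" unfolding L_def by (rule l.subspace_image[OF Ht_subspace])
  moreover have "a * n \<in> L" if "a \<in> Ht" "n \<in> L" for a n
    using that Ht_mult unfolding L_def by (auto simp: mult.assoc[symmetric])
  moreover have "L \<subseteq> Ht" unfolding L_def using Ht_mult[OF _ casimir_in] by blast
  ultimately obtain f where f: "f \<in> L" "\<And>n. n \<in> L \<Longrightarrow> n * f = n"
    using left_ideal_idempotent[of L] by blast
  have fH: "f \<in> Ht" using f(1) \<open>L \<subseteq> Ht\<close> by blast
  have "1 * casimir \<in> L" unfolding L_def using one_in_bases(1) by (rule imageI)
  then have cf: "casimir * f = casimir" using f(2) by simp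
  have "f - 1 \<in> Ht" by (rule subspace_diff[OF Ht_subspace fH one_in_bases(1)])
  then obtain y where y: "y \<in> Hs" "S y = f - 1" using S_Hs_surj by blast
  then obtain b where b: "b \<in> Ht" "S b = y" using S_Ht_surj by blast
  have "b * casimir = 0" using casimir_commute[OF b(1)] cf by (simp add: b y right_diff_distrib)
  then have "b = 0" by (rule mult_casimir_cancel[OF char b(1)])
  then have f1: "f = 1" using y(2) b(2) module_hom.zero[OF antipode_lin[unfolded linear_iff_module_hom]] by simp
  obtain d where d: "d \<in> Ht" "d * casimir = 1" using f(1) f1 unfolding L_def by auto
  have 0: "(casimir * d - 1) * casimir = 0" using d(2) by (simp add: left_diff_distrib mult.assoc)
  have "casimir * d - 1 = 0"
    by (rule mult_casimir_cancel[OF char _ 0]) (intro subspace_diff[OF Ht_subspace] Ht_mult casimir_in d one_in_bases)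
  then show ?thesis using d by auto
qed

text \<open>
  In terms of \<open>c\<close>, the condition on \<open>g\<close> reads \<open>\<epsilon>(b) = \<epsilon>(b g\<^sup>-\<^sup>1 c)\<close>, and \<open>\<epsilon>\<close> is nondegenerate.
\<close>

lemma min_datum_iff:
  assumes char: "CHAR('k) = 0"
  shows "min_datum scale \<Delta> \<epsilon> g \<longleftrightarrow> g = casimir"
proof
  assume "min_datum scale \<Delta> \<epsilon> g"
  then have g: "g \<in> Ht" and inv: "invertible_elem g" and e: "\<And>b. b \<in> Ht \<Longrightarrow> \<epsilon> b = Tr (inverse_elem g * b)"
    by (auto simp: min_datum_def)
  obtain h where h: "g * h = 1" "h * g = 1" using inv by (auto simp: invertible_elem_def)
  have hH: "h \<in> Ht" by (rule Ht_inverse[OF g h(2,1)])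
  interpret e: Vector_Spaces.linear scale "(*)" \<epsilon> by (rule counit_lin)
  have "h * casimir - 1 = 0"
  proof (rule counit_nondegenerate)
    show "h * casimir - 1 \<in> Ht" by (intro subspace_diff[OF Ht_subspace] Ht_mult casimir_in hH one_in_bases)
    fix a assume a: "a \<in> Ht"
    have "\<epsilon> a = Tr (a * h)" using e[OF a] Tr_commute[OF hH a] by (simp add: inverse_elem_eq[OF h])
    also have "\<dots> = \<epsilon> (a * (h * casimir))" using Tr_eq[OF Ht_mult[OF a hH]] by (simp add: mult.assoc)
    finally show "\<epsilon> (a * (h * casimir - 1)) = 0" by (simp add: right_diff_distrib e.diff)
  qed
  then have "g * (h * casimir) = g" by simp
  then show "g = casimir" using h by (simp add: mult.assoc[symmetric])
next
  assume "g = casimir"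
  obtain d where d: "d \<in> Ht" "casimir * d = 1" "d * casimir = 1" using casimir_invertible[OF char] by blast
  have "\<epsilon> b = Tr (d * b)" if b: "b \<in> Ht" for b
    using Tr_eq[OF Ht_mult[OF b d(1)]] Tr_commute[OF d(1) b] d(3) by (simp add: mult.assoc)
  then show "min_datum scale \<Delta> \<epsilon> g"
    unfolding min_datum_def \<open>g = casimir\<close> inverse_elem_eq[OF d(2,3)] invertible_elem_def
    using casimir_in d by blast
qed

text \<open>
  By \<open>d z = S\<^sup>2(z) d\<close> the element \<open>S(1\<^sub>1) d 1\<^sub>2\<close> equals \<open>S(1\<^sub>1) S\<^sup>2(1\<^sub>2) d\<close>, and flipping \<open>\<Delta>(1)\<close> identifies the first two factors with \<open>1\<^sub>2 S(1\<^sub>1) = c\<close>.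
\<close>

lemma deformation_casimir_inverse:
  assumes d: "casimir * d = 1" "d * casimir = 1"
  shows "deformation scale \<Delta> D \<epsilon> S d casimir"
proof
  show dH: "d \<in> Ht" by (rule Ht_inverse[OF casimir_in d(2,1)])
  show "d * casimir = 1" "casimir * d = 1" by (rule d)+
  have dz: "d * z = S (S z) * d" if "z \<in> Ht" for z
  proof -
    have "d * z = d * (z * casimir) * d" using d by (simp add: mult.assoc)
    also have "\<dots> = d * casimir * S (S z) * d" by (simp only: casimir_commute[OF that] mult.assoc)
    finally show ?thesis using d by simp
  qed
  have "sw (\<lambda>a b. S a * d * b) 1 = sw (\<lambda>a b. S a * d * et b) 1"
    by (rule one_et[where sW = scale, symmetric]) (intro lins)
  also have "\<dots> = sw (\<lambda>a b. S a * S (S (et b)) * d) 1"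
    by (simp only: mult.assoc dz[OF et_in])
  also have "\<dots> = sw (\<lambda>a b. S a * S (S b) * d) 1"
    by (rule one_et[where sW = scale]) (intro lins)
  also have "\<dots> = sw (\<lambda>a b. S a * S (S b)) 1 * d" by (simp only: mult_sw)
  also have "sw (\<lambda>a b. S a * S (S b)) 1 = casimir"
    unfolding casimir_def by (rule sw_flip[where sW = scale]) (intro lins)
  finally show "sw (\<lambda>a b. S a * d * b) 1 = 1" using d by simp
qed

end

context deformation
begin

lemma deformation_elem_iff: "deformation_elem scale \<Delta> \<epsilon> S q \<longleftrightarrow> S (S q) = q"
proof -
  have "lift2 scale scale (\<lambda>a b. S a * q * b) (\<Delta> 1) = sw (\<lambda>a b. S a * q * b) 1"
    by (rule lift2_comult) (intro lins)
  moreover have "invertible_elem q" unfolding invertible_elem_def using pq qp by blast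
  ultimately show ?thesis unfolding deformation_elem_def using q_in q_cond by simp
qed

end

section \<open>The deformation with involutive antipode on the minimal subalgebra\<close>

locale trace_deformation = deformation scale \<Delta> D \<epsilon> S q p 
  for scale :: "'k::field \<Rightarrow> 'a::{ring, monoid_mult} \<Rightarrow> 'a" and \<Delta> D \<epsilon> S q p +
  assumes p_eq: "p = casimir"
begin

lemma conj_S_S:
  assumes "z \<in> Ht"
  shows "p * S (S z) * q = z"
proof -
  have "p * S (S z) * q = z * p * q" by (simp only: casimir_commute[OF assms] p_eq)
  then show ?thesis by (simp only: cancel)
qed

lemma S_S_q: "S (S q) = q"
proof -
  have "p * S (S q) * q = q" by (rule conj_S_S[OF q_in])
  then have "q * (p * S (S q) * q) * p = q * q * p" by simp
  then show ?thesis by (simp only: mult.assoc cancel qp mult_1_right)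
qed

text \<open>
  On a product \<open>z y\<close> the square of the deformed antipode is \<open>(p S\<^sup>2(z) q) (S(q) S\<^sup>2(y) S(p))\<close>.  The first factor is \<open>z\<close>; for \<open>y = S(t)\<close>
  with \<open>t\<close> in \<open>H\<^sub>t\<close> the second is \<open>S(p S\<^sup>2(t) q) = S(t) = y\<close>.
\<close>

lemma Sq_Sq_min:
  assumes "h \<in> min_subalgebra scale \<Delta>q \<epsilon>q"
  shows "Sq (Sq h) = h"
proof -
  interpret d: sweedler scale \<Delta>q Dq \<epsilon>q Sq by (rule sweedler_deformed)
  have l: "Vector_Spaces.linear scale scale (\<lambda>h. Sq (Sq h))" by (intro d.lin)
  interpret vp: vector_space_pair scale scale by unfold_locales
  have gen: "Sq (Sq (z * y)) = z * y" if z: "z \<in> Ht" and y: "y \<in> Hs" for z y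
  proof -
    obtain t where t: "t \<in> Ht" "S t = y" using S_Ht_surj[OF y] by blast
    have SS: "S (S z) \<in> Ht" by (intro S_Hs_in S_Ht_in z)
    have "S (p * S (S t) * q) = S t" by (simp only: conj_S_S[OF t(1)])
    then have y': "S q * S (S y) * S p = y" by (simp only: S_mult t(2) mult.assoc)
    have "Sq (Sq (z * y)) = p * (S q * S (S z)) * S (S y) * S p * q"
      by (simp only: Sq S_mult mult.assoc)
    also have "\<dots> = p * S (S z) * (S q * S (S y) * S p) * q"
      by (simp only: Ht_Hs_commute[OF SS S_Ht_in[OF q_in], symmetric] mult.assoc)
    also have "\<dots> = p * S (S z) * q * y"
      by (simp only: y') (simp only: mult.assoc Ht_Hs_commute[OF q_in y])
    finally show ?thesis by (simp only: conj_S_S[OF z])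
  qed
  show ?thesis
    by (rule vp.linear_eq_on[OF l linear_id' assms[unfolded min_subalgebra_def Ht_deformed Hs_deformed]])
      (use gen in blast)
qed

end

theorem mainTheorem2:
  fixes scale :: "'k::field \<Rightarrow> 'a::{ring, monoid_mult} \<Rightarrow> 'a"
    and \<Delta> :: "'a \<Rightarrow> ('k, 'a) tensor2" and \<epsilon> :: "'a \<Rightarrow> 'k" and S :: "'a \<Rightarrow> 'a"
  assumes H: "weak_hopf_algebra scale \<Delta> \<epsilon> S"
  shows
    "(\<forall>q. deformation_elem scale \<Delta> \<epsilon> S q \<longrightarrow>
        weak_hopf_algebra scale (deform_comult scale q \<Delta>) (deform_counit q \<epsilon>) (deform_antipode q S))
     \<and>
     ((\<forall>p::'k poly. degree p > 0 \<longrightarrow> (\<exists>x. poly p x = 0)) \<and> CHAR('k) = 0 \<longrightarrow>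
        (\<exists>!g. min_datum scale \<Delta> \<epsilon> g) \<and>
        (\<forall>g q. min_datum scale \<Delta> \<epsilon> g \<and> q = inverse_elem g \<longrightarrow>
           deformation_elem scale \<Delta> \<epsilon> S q \<and>
           weak_hopf_algebra scale (deform_comult scale q \<Delta>) (deform_counit q \<epsilon>) (deform_antipode q S) \<and>
           (\<forall>h\<in>min_subalgebra scale (deform_comult scale q \<Delta>) (deform_counit q \<epsilon>).
              deform_antipode q S (deform_antipode q S h) = h)) \<and>
        (\<exists>\<Delta>\<^sub>0 \<epsilon>\<^sub>0 S\<^sub>0 q.
           weak_hopf_algebra scale \<Delta>\<^sub>0 \<epsilon>\<^sub>0 S\<^sub>0 \<and>
           (\<forall>h\<in>min_subalgebra scale \<Delta>\<^sub>0 \<epsilon>\<^sub>0. S\<^sub>0 (S\<^sub>0 h) = h) \<and>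
           deformation_elem scale \<Delta>\<^sub>0 \<epsilon>\<^sub>0 S\<^sub>0 q \<and>
           \<Delta> = deform_comult scale q \<Delta>\<^sub>0 \<and> \<epsilon> = deform_counit q \<epsilon>\<^sub>0 \<and> S = deform_antipode q S\<^sub>0))"
proof -
  interpret H: weak_hopf_algebra scale \<Delta> \<epsilon> S by (rule H)
  obtain D where D: "\<And>h. \<Delta> h = sum_pairs (tensor2 scale) (D h)"
    using tensor2_space_sum_pairs[OF H.vector_space_axioms H.comult_in] by metis
  interpret sweedler_wha scale \<Delta> D \<epsilon> S
    by (intro sweedler_wha.intro sweedler.intro sweedler_axioms.intro H.unital_algebra_axioms H D
        H.comult_linear H.counit_linear H.antipode_linear)
  have 1: "weak_hopf_algebra scale (deform_comult scale q \<Delta>) (deform_counit q \<epsilon>) (deform_antipode q S)"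
    if q: "deformation_elem scale \<Delta> \<epsilon> S q" for q
  proof -
    obtain p where p: "q * p = 1" "p * q = 1"
      using q by (auto simp: deformation_elem_def invertible_elem_def)
    have "lift2 scale scale (\<lambda>a b. S a * q * b) (\<Delta> 1) = sw (\<lambda>a b. S a * q * b) 1"
      by (rule lift2_comult) (intro lins)
    then interpret deformation scale \<Delta> D \<epsilon> S q p
      using p q by unfold_locales (auto simp: deformation_elem_def)
    show ?thesis by (rule weak_hopf_deformed)
  qed
  have 2: "\<exists>!g. min_datum scale \<Delta> \<epsilon> g" if "CHAR('k) = 0"
    by (simp add: min_datum_iff[OF that])
  have 3: "trace_deformation scale \<Delta> D \<epsilon> S (inverse_elem casimir) casimir" if char: "CHAR('k) = 0"
  proof -
    obtain d where d: "casimir * d = 1" "d * casimir = 1" using casimir_invertible[OF char] by blast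
    show ?thesis unfolding inverse_elem_eq[OF d]
      by (intro trace_deformation.intro trace_deformation_axioms.intro deformation_casimir_inverse d refl)
  qed
  have 4: "deformation_elem scale \<Delta> \<epsilon> S q \<and>
      (\<forall>h\<in>min_subalgebra scale (deform_comult scale q \<Delta>) (deform_counit q \<epsilon>).
        deform_antipode q S (deform_antipode q S h) = h)"
    if char: "CHAR('k) = 0" and g: "min_datum scale \<Delta> \<epsilon> g" and q: "q = inverse_elem g" for g q
  proof -
    have q': "q = inverse_elem casimir" using g q by (simp add: min_datum_iff[OF char])
    interpret trace_deformation scale \<Delta> D \<epsilon> S q casimir unfolding q' by (rule 3[OF char])
    show ?thesis using deformation_elem_iff S_S_q Sq_Sq_min by blast
  qed
  have 5: "\<exists>\<Delta>\<^sub>0 \<epsilon>\<^sub>0 S\<^sub>0 q. weak_hopf_algebra scale \<Delta>\<^sub>0 \<epsilon>\<^sub>0 S\<^sub>0 \<and>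
      (\<forall>h\<in>min_subalgebra scale \<Delta>\<^sub>0 \<epsilon>\<^sub>0. S\<^sub>0 (S\<^sub>0 h) = h) \<and> deformation_elem scale \<Delta>\<^sub>0 \<epsilon>\<^sub>0 S\<^sub>0 q \<and>
      \<Delta> = deform_comult scale q \<Delta>\<^sub>0 \<and> \<epsilon> = deform_counit q \<epsilon>\<^sub>0 \<and> S = deform_antipode q S\<^sub>0"
    if char: "CHAR('k) = 0"
  proof -
    interpret td: trace_deformation scale \<Delta> D \<epsilon> S "inverse_elem casimir" casimir by (rule 3[OF char])
    have "casimir * 1 \<in> min_subalgebra scale td.\<Delta>q td.\<epsilon>q"
      unfolding min_subalgebra_def td.Ht_deformed td.Hs_deformed
      by (rule H.span_base) (use casimir_in one_in_bases(2) in blast)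
    then have "td.Sq (td.Sq casimir) = casimir" using td.Sq_Sq_min by simp
    then have "deformation_elem scale td.\<Delta>q td.\<epsilon>q td.Sq casimir" by (rule td.deformation_elem_undeform)
    then show ?thesis
      using td.weak_hopf_deformed td.Sq_Sq_min td.undeform[symmetric] by blast
  qed
  show ?thesis using 1 2 4 5 by blast
qed
end
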